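(* For each $n \geq 1$, let $u = (u_{ij})_{1\le i,j\le n}$ be the generating unitary matrix of the Brown algebra $U_n^{\mathrm{nc}}$, let $h$ be the free Haar trace on $U_n^{\mathrm{nc}}$, and for $p \geq 1$ let $\chi(u^p) = \sum_{i=1}^n (u^p)_{ii} \in U_n^{\mathrm{nc}}$. Then the family of noncommutative random variables $(\chi(u^p))_{p\geq 1}$ in $(U_n^{\mathrm{nc}}, h)$ is asymptotically, as $n \to \infty$, a family of $*$-free circular variables of mean $0$ and covariance $1$.
   Context: **Brown algebra.** For $n\ge 1$, $U_n^{\mathrm{nc}}$ is the universal unital noncommutative complex $*$-algebra generated by $n^2$ elements $u_{ij}$, $1\le i,j\le n$, subject to the relations $\sum_{k=1}^n u_{ki}^* u_{kj} = \delta_{ij} = \sum_{k=1}^n u_{ik}u_{jk}^*$ for all $1\le i,j\le n$, i.e. such that the matrix $u=(u_{ij})$ is unitary. The matrix $u^*$ has entries $(u^* )_{ij} = u_{ji}^*$. For a matrix $A=(a_{ij})_{1\le i,j\le n}$ with entries in an algebra, $\chi(A)=\sum_{i=1}^n a_{ii}$ denotes the (unnormalized) trace. **Free cumulants.** Let $NC(s)$ be the set of noncrossing partitions of $\{1,\dots,s\}$. For a unital algebra $\mathcal{A}$ with a unital linear functional $\phi$, the free cumulants $\kappa_r:\mathcal{A}^r\to\mathbb{C}$, $r\ge 1$, are the multilinear functionals determined by the moment-cumulant formula $\phi(a_1\cdots a_s)=\sum_{\pi\in NC(s)}\kappa_\pi[a_1,\dots,a_s]$ for all $s\ge1$ and $a_1,\dots,a_s\in\mathcal{A}$,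 where $\kappa_\pi[a_1,\dots,a_s]=\prod_{V=\{v_1<\dots<v_l\}\in\pi}\kappa_l(a_{v_1},\dots,a_{v_l})$. **Free Haar trace.** $h$ is the Haar trace for the free convolution on the unitary dual group (Cébron–Ulrich, McClanahan). It is the unital linear functional (a faithful tracial state) on $U_n^{\mathrm{nc}}$ determined by the following free cumulants of the entries of $u$ and $u^*$. For $1\le i_1,j_1,\dots,i_r,j_r\le n$ and $\epsilon_1,\dots,\epsilon_r\in\{\emptyset,*\}$ (with $u^{\emptyset}=u$), if $j_{l-1}=i_l$ for $2\le l\le r$ and $j_r=i_1$, $r$ is even, and the $\epsilon_l$ are alternating ($\epsilon_l\ne\epsilon_{l+1}$ for $1\le l\le r-1$), then $$\kappa_r\big((u^{\epsilon_1})_{i_1j_1},\dots,(u^{\epsilon_r})_{i_rj_r}\big)=n^{1-r}(-1)^{\frac r2-1}C_{\frac r2-1},\qquad C_m=\frac{(2m)!}{(m+1)!\,m!};$$ otherwise this cumulant is $0$. **Asymptotic statement.** A $*$-free family of circular variables of mean $0$ and covariance $1$ is a family $(c_p)_{p\ge1}$ in a noncommutative $*$-probability space whose only nonvanishing joint free cumulants in the variables $c_p, c_p^*$ ($p\geq 1$) are $\kappa_2(c_p,c_p^* )=\kappa_2(c_p^*,c_p)=1$, $p\ge1$. "Asymptotically" means convergence in joint $*$-distribution: for every $s\ge1$, $p_1,\dots,p_s\ge1$ and $e_1,\dots,e_s\in\{\emptyset,*\}$, the joint moment $h\big(\chi(u^{p_1})^{e_1}\cdots\chi(u^{p_s})^{e_s}\big)$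 converges as $n\to\infty$ to the corresponding joint moment of $c_{p_1}^{e_1},\dots,c_{p_s}^{e_s}$ (equivalently, all joint free cumulants of the variables $\chi(u^p),\chi(u^p)^*$ converge to those of the $c_p,c_p^*$). *)

theory Defs
  imports
    "HOL-Algebra.Algebra"
    "HOL-Algebra.Algebraic_Closure_Type"
    "HOL-Library.Poly_Mapping"
    "HOL-Library.Disjoint_Sets"
    "HOL-Library.Nonpos_Ints"
begin

section \<open>Unital complex star-algebras\<close>

record 'a star_algebra = "(complex, 'a) module" +
  star :: "'a \<Rightarrow> 'a" (\<open>_\<^sup>\<star>\<index>\<close> [1000] 999)

text \<open>The library locale \<open>algebra\<close> is commutative, hence the separate locale here.\<close>

locale complex_star_algebra =
  ring A + scalar: module "ring_of_type_algebra :: complex ring" A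
    for A :: "('a, 'm) star_algebra_scheme" (structure) +
  assumes smult_mult_left:
      "\<lbrakk>x \<in> carrier A; y \<in> carrier A\<rbrakk> \<Longrightarrow> (c \<odot> x) \<otimes> y = c \<odot> (x \<otimes> y)"
    and smult_mult_right:
      "\<lbrakk>x \<in> carrier A; y \<in> carrier A\<rbrakk> \<Longrightarrow> x \<otimes> (c \<odot> y) = c \<odot> (x \<otimes> y)"
    and star_closed [simp, intro]: "x \<in> carrier A \<Longrightarrow> x\<^sup>\<star> \<in> carrier A"
    and star_star [simp]: "x \<in> carrier A \<Longrightarrow> (x\<^sup>\<star>)\<^sup>\<star> = x"
    and star_add: "\<lbrakk>x \<in> carrier A; y \<in> carrier A\<rbrakk> \<Longrightarrow> (x \<oplus> y)\<^sup>\<star> = x\<^sup>\<star> \<oplus> y\<^sup>\<star>"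
    and star_smult: "x \<in> carrier A \<Longrightarrow> (c \<odot> x)\<^sup>\<star> = cnj c \<odot> x\<^sup>\<star>"
    and star_mult: "\<lbrakk>x \<in> carrier A; y \<in> carrier A\<rbrakk> \<Longrightarrow> (x \<otimes> y)\<^sup>\<star> = y\<^sup>\<star> \<otimes> x\<^sup>\<star>"

definition unital_linear_functional ::
    "('a, 'm) star_algebra_scheme \<Rightarrow> ('a \<Rightarrow> complex) \<Rightarrow> bool" where
  "unital_linear_functional A \<phi> \<longleftrightarrow>
     (\<forall>x\<in>carrier A. \<forall>y\<in>carrier A. \<phi> (x \<oplus>\<^bsub>A\<^esub> y) = \<phi> x + \<phi> y) \<and>
     (\<forall>c. \<forall>x\<in>carrier A. \<phi> (c \<odot>\<^bsub>A\<^esub> x) = c * \<phi> x) \<and>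
     \<phi> \<one>\<^bsub>A\<^esub> = 1"

definition star_prob_space ::
    "('a, 'm) star_algebra_scheme \<Rightarrow> ('a \<Rightarrow> complex) \<Rightarrow> bool" where
  "star_prob_space A \<phi> \<longleftrightarrow>
     complex_star_algebra A \<and> unital_linear_functional A \<phi> \<and>
     (\<forall>x\<in>carrier A. \<phi> (x\<^sup>\<star>\<^bsub>A\<^esub> \<otimes>\<^bsub>A\<^esub> x) \<in> \<real>\<^sub>\<ge>\<^sub>0)"

definition star_if :: "('a, 'm) star_algebra_scheme \<Rightarrow> bool \<Rightarrow> 'a \<Rightarrow> 'a" where
  "star_if A e x = (if e then x\<^sup>\<star>\<^bsub>A\<^esub> else x)"

definition list_mult :: "('a, 'm) monoid_scheme \<Rightarrow> 'a list \<Rightarrow> 'a" where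
  "list_mult A xs = foldr (\<otimes>\<^bsub>A\<^esub>) xs \<one>\<^bsub>A\<^esub>"

section \<open>Noncrossing partitions and free cumulants\<close>

text \<open>Positions in a list count from 0, so the partitions are of \<open>{..<s}\<close> rather than
  of \<open>{1..s}\<close>. The list \<open>nths xs V\<close> keeps the entries of \<open>xs\<close> at the positions in \<open>V\<close>,
  in their order.\<close>

definition NC :: "nat \<Rightarrow> nat set set set" where
  "NC s = {P. partition_on {..<s} P \<and>
     (\<forall>V\<in>P. \<forall>W\<in>P. V \<noteq> W \<longrightarrow>
        \<not> (\<exists>a b c d. a < b \<and> b < c \<and> c < d \<and> a \<in> V \<and> c \<in> V \<and> b \<in> W \<and> d \<in> W))}"

lemma NC_subset: "NC s \<subseteq> Pow (Pow {..<s})"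
  by (auto simp: NC_def partition_on_def)

lemma finite_NC: "finite (NC s)"
  by (rule finite_subset[OF NC_subset]) auto

lemma top_in_NC: "s > 0 \<Longrightarrow> {{..<s}} \<in> NC s"
  by (auto simp: NC_def partition_on_def disjoint_def)

lemma NC_proper_block:
  assumes "P \<in> NC s - {{{..<s}}}" "V \<in> P"
  shows "V \<subset> {..<s}"
proof (rule ccontr)
  assume "\<not> V \<subset> {..<s}"
  moreover have P: "\<Union>P = {..<s}" "disjoint P" "{} \<notin> P"
    using assms by (auto simp: NC_def partition_on_def)
  ultimately have V: "V = {..<s}" using assms(2) by blast
  have "W = V" if "W \<in> P" for W
  proof (rule ccontr)
    assume "W \<noteq> V"
    hence "W \<inter> V = {}" using P(2) that assms(2) by (auto simp: disjoint_def)
    moreover have "W \<subseteq> V" using P(1) that V by blast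
    ultimately show False using P(3) that by (simp add: Int_absorb2)
  qed
  hence "P = {{..<s}}" using V assms(2) by blast
  thus False using assms(1) by simp
qed

lemma length_nths_less:
  assumes "V \<subset> {..<length xs}"
  shows "length (nths xs V) < length xs"
proof -
  have "{i. i < length xs \<and> i \<in> V} \<subset> {..<length xs}" using assms by auto
  hence "card {i. i < length xs \<and> i \<in> V} < card {..<length xs}"
    by (intro psubset_card_mono) auto
  thus ?thesis by (simp add: length_nths)
qed

text \<open>The moment-cumulant formula, solved for the term of the one-block partition;
  see \<open>moment_cumulant\<close> and \<open>free_cumulant_unique\<close> below. Here \<open>\<kappa>\<^sub>r(a\<^sub>1,\<dots>,a\<^sub>r)\<close> is
  the value on the list \<open>[a\<^sub>1,\<dots>,a\<^sub>r]\<close>.\<close>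

function free_cumulant ::
    "('a, 'm) monoid_scheme \<Rightarrow> ('a \<Rightarrow> complex) \<Rightarrow> 'a list \<Rightarrow> complex" where
  "free_cumulant A \<phi> xs =
     \<phi> (list_mult A xs) -
     (\<Sum>P \<in> NC (length xs) - {{{..<length xs}}}. \<Prod>V\<in>P. free_cumulant A \<phi> (nths xs V))"
  by pat_completeness auto
termination
proof (relation "measure (\<lambda>(A, \<phi>, xs). length xs)", goal_cases)
  case 1
  show ?case by simp
next
  case (2 A \<phi> xs P V)
  show ?case using length_nths_less[OF NC_proper_block[OF 2]] by simp
qed

declare free_cumulant.simps [simp del]

lemma moment_cumulant:
  assumes "xs \<noteq> []"
  shows "\<phi> (list_mult A xs) =
    (\<Sum>P \<in> NC (length xs). \<Prod>V\<in>P. free_cumulant A \<phi> (nths xs V))"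
proof -
  have "nths xs {..<length xs} = xs" by (simp add: nths_all)
  hence "(\<Sum>P \<in> NC (length xs). \<Prod>V\<in>P. free_cumulant A \<phi> (nths xs V)) =
     free_cumulant A \<phi> xs +
     (\<Sum>P \<in> NC (length xs) - {{{..<length xs}}}. \<Prod>V\<in>P. free_cumulant A \<phi> (nths xs V))"
    using assms by (subst sum.remove[OF finite_NC top_in_NC]) auto
  thus ?thesis using free_cumulant.simps[of A \<phi> xs] by simp
qed

lemma free_cumulant_unique:
  assumes "\<And>ys. \<lbrakk>ys \<noteq> []; set ys \<subseteq> carrier A\<rbrakk> \<Longrightarrow> \<phi> (list_mult A ys) =
      (\<Sum>P \<in> NC (length ys). \<Prod>V\<in>P. \<kappa> (nths ys V))"
    and "xs \<noteq> []" "set xs \<subseteq> carrier A"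
  shows "\<kappa> xs = free_cumulant A \<phi> xs"
  using assms(2,3)
proof (induction xs rule: length_induct)
  case (1 xs)
  let ?T = "{{..<length xs}}" and ?N = "NC (length xs)"
  have all: "nths xs {..<length xs} = xs" by (simp add: nths_all)
  have "(\<Prod>V\<in>P. \<kappa> (nths xs V)) = (\<Prod>V\<in>P. free_cumulant A \<phi> (nths xs V))"
    if "P \<in> ?N - {?T}" for P
  proof (rule prod.cong)
    fix V assume V: "V \<in> P"
    have "V \<noteq> {}" using that V by (auto simp: NC_def partition_on_def)
    then obtain v where v: "v \<in> V" by blast
    have sub: "V \<subset> {..<length xs}" by (rule NC_proper_block[OF that V])
    hence "v < length xs" using v by auto
    hence "xs ! v \<in> set (nths xs V)" using v by (auto simp: set_nths)
    hence "nths xs V \<noteq> []" by auto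
    moreover have "set (nths xs V) \<subseteq> carrier A"
      using 1(3) set_nths_subset[of xs V] by blast
    ultimately show "\<kappa> (nths xs V) = free_cumulant A \<phi> (nths xs V)"
      using 1(1) length_nths_less[OF sub] by blast
  qed simp
  hence "(\<Sum>P \<in> ?N - {?T}. \<Prod>V\<in>P. \<kappa> (nths xs V)) =
         (\<Sum>P \<in> ?N - {?T}. \<Prod>V\<in>P. free_cumulant A \<phi> (nths xs V))"
    by (intro sum.cong) auto
  moreover have "\<phi> (list_mult A xs) =
      \<kappa> xs + (\<Sum>P \<in> ?N - {?T}. \<Prod>V\<in>P. \<kappa> (nths xs V))"
    using assms(1)[OF 1(2,3)] 1(2) all
    by (subst (asm) sum.remove[OF finite_NC top_in_NC]) auto
  ultimately show ?case using free_cumulant.simps[of A \<phi> xs] by simp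
qed

section \<open>Star-algebras given by generators and relations\<close>

text \<open>Words in the letters \<open>g\<close> and \<open>g\<^sup>*\<close>, encoded as \<open>(g, False)\<close> and \<open>(g, True)\<close>.
  The free monoid is written additively because the convolution product of the library
  type of finitely supported functions is indexed by a \<open>monoid_add\<close>.\<close>

datatype 'g star_word = Star_Word (letters: "('g \<times> bool) list")

instantiation star_word :: (type) monoid_add
begin

definition "0 = Star_Word []"

definition "v + w = Star_Word (letters v @ letters w)"

instance by standard (auto simp: zero_star_word_def plus_star_word_def)

end

definition word_star :: "'g star_word \<Rightarrow> 'g star_word" where
  "word_star w = Star_Word (rev (map (\<lambda>(g, e). (g, \<not> e)) (letters w)))"

type_synonym 'g star_poly = "'g star_word \<Rightarrow>\<^sub>0 complex"

lemma word_star_word_star [simp]: "word_star (word_star w) = w"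
  by (cases w) (auto simp: word_star_def rev_map comp_def case_prod_beta)

lemma inj_word_star: "inj word_star"
  by (metis injI word_star_word_star)

lemma word_star_plus: "word_star (v + w) = word_star w + word_star v"
  by (simp add: word_star_def plus_star_word_def)

definition poly_scale :: "complex \<Rightarrow> 'g star_poly \<Rightarrow> 'g star_poly" where
  "poly_scale c = Poly_Mapping.map ((*) c)"

text \<open>Since \<open>word_star\<close> is an involution, the coefficient of \<open>w\<close> in the star of \<open>f\<close> is the
  conjugate of the coefficient of \<open>word_star w\<close> in \<open>f\<close>.\<close>

definition poly_star :: "'g star_poly \<Rightarrow> 'g star_poly" where
  "poly_star f = Poly_Mapping.map cnj (Poly_Mapping.map_key word_star f)"

lemma lookup_poly_star: "Poly_Mapping.lookup (poly_star f) w = cnj (Poly_Mapping.lookup f (word_star w))"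
  by (simp add: poly_star_def Poly_Mapping.map.rep_eq map_key.rep_eq[OF inj_word_star] when_def)

lemma poly_star_single: "poly_star (Poly_Mapping.single v a) = Poly_Mapping.single (word_star v) (cnj a)"
  by (rule poly_mapping_eqI) (auto simp: lookup_poly_star lookup_single when_def)

lemma poly_star_add: "poly_star (f + g) = poly_star f + poly_star g"
  by (rule poly_mapping_eqI) (simp add: lookup_poly_star lookup_add)

lemma poly_star_star: "poly_star (poly_star f) = f"
  by (rule poly_mapping_eqI) (simp add: lookup_poly_star)

lemma star_poly_induct [case_names zero single]:
  assumes "P 0" "\<And>f w b. P f \<Longrightarrow> P (f + Poly_Mapping.single w b)"
  shows "P (f :: 'g star_poly)"
proof (induction f rule: update_induct)
  case const
  show ?case by (rule assms)
next
  case (update f a b)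
  have "Poly_Mapping.update a b f = f + Poly_Mapping.single a b"
    using update(1) by (auto intro!: poly_mapping_eqI simp: lookup_update lookup_add lookup_single in_keys_iff)
  thus ?case using update assms by simp
qed

lemma poly_star_zero: "poly_star 0 = 0"
  by (rule poly_mapping_eqI) (simp add: lookup_poly_star)

lemma poly_star_mult: "poly_star (f * g) = poly_star g * poly_star f"
proof -
  have 1: "poly_star (Poly_Mapping.single v a * g) = poly_star g * poly_star (Poly_Mapping.single v a)" for v a
    by (induction g rule: star_poly_induct)
      (simp_all add: poly_star_zero poly_star_single mult_single word_star_plus mult.commute
        distrib_left distrib_right poly_star_add)
  show ?thesis
    by (induction f rule: star_poly_induct)
      (simp_all add: poly_star_zero 1 distrib_left distrib_right poly_star_add)
qed

lemma lookup_poly_scale: "Poly_Mapping.lookup (poly_scale c f) w = c * Poly_Mapping.lookup f w"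
  by (simp add: poly_scale_def Poly_Mapping.map.rep_eq when_def)

lemma poly_scale_mult: "poly_scale c f = Poly_Mapping.single 0 c * f"
  and poly_scale_mult2: "poly_scale c f = f * Poly_Mapping.single 0 c"
proof -
  have add: "poly_scale c (f + g) = poly_scale c f + poly_scale c g" for f g :: "'a star_poly"
    by (rule poly_mapping_eqI) (simp add: lookup_poly_scale lookup_add distrib_left)
  have sg: "poly_scale c (Poly_Mapping.single v a) = Poly_Mapping.single v (c * a)" for v :: "'a star_word" and a
    by (rule poly_mapping_eqI) (auto simp: lookup_poly_scale lookup_single when_def)
  have z: "poly_scale c (0 :: 'a star_poly) = 0"
    by (rule poly_mapping_eqI) (auto simp: lookup_poly_scale)
  show "poly_scale c f = Poly_Mapping.single 0 c * f"
    by (induction f rule: star_poly_induct) (simp_all add: z add sg mult_single distrib_left)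
  show "poly_scale c f = f * Poly_Mapping.single 0 c"
    by (induction f rule: star_poly_induct) (simp_all add: z add sg mult_single distrib_right mult.commute)
qed

lemma keys_poly_scale: "Poly_Mapping.keys (poly_scale c f) \<subseteq> Poly_Mapping.keys f"
  by (auto simp: in_keys_iff lookup_poly_scale)

definition free_star_algebra :: "'g set \<Rightarrow> 'g star_poly star_algebra" where
  "free_star_algebra G =
    \<lparr>carrier = {f. \<forall>w\<in>Poly_Mapping.keys f. fst ` set (letters w) \<subseteq> G},
     monoid.mult = (*), one = 1, ring.zero = 0, add = (+),
     module.smult = poly_scale, star = poly_star\<rparr>"

lemma fsa_simps:
  "carrier (free_star_algebra G) = {f. \<forall>w\<in>Poly_Mapping.keys f. fst ` set (letters w) \<subseteq> G}"
  "monoid.mult (free_star_algebra G) = (*)"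
  "one (free_star_algebra G) = 1" "ring.zero (free_star_algebra G) = 0"
  "add (free_star_algebra G) = (+)" "module.smult (free_star_algebra G) = poly_scale"
  "star (free_star_algebra G) = poly_star"
  by (auto simp: free_star_algebra_def)

definition free_gen :: "'g \<Rightarrow> 'g star_poly" where
  "free_gen g = Poly_Mapping.single (Star_Word [(g, False)]) 1"

definition star_ideal :: "('a, 'm) star_algebra_scheme \<Rightarrow> 'a set \<Rightarrow> bool" where
  "star_ideal A I \<longleftrightarrow> ideal I A \<and> (\<forall>x\<in>I. x\<^sup>\<star>\<^bsub>A\<^esub> \<in> I)"

definition gen_star_ideal :: "('a, 'm) star_algebra_scheme \<Rightarrow> 'a set \<Rightarrow> 'a set" where
  "gen_star_ideal A S = \<Inter>{I. star_ideal A I \<and> S \<subseteq> I}"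

definition quot_star_algebra ::
    "('a, 'm) star_algebra_scheme \<Rightarrow> 'a set \<Rightarrow> 'a set star_algebra" where
  "quot_star_algebra A I =
    \<lparr>carrier = carrier (A Quot I), monoid.mult = monoid.mult (A Quot I),
     one = one (A Quot I), ring.zero = ring.zero (A Quot I), add = add (A Quot I),
     module.smult = (\<lambda>c C. \<Union>x\<in>C. I +>\<^bsub>A\<^esub> (c \<odot>\<^bsub>A\<^esub> x)),
     star = (\<lambda>C. \<Union>x\<in>C. I +>\<^bsub>A\<^esub> x\<^sup>\<star>\<^bsub>A\<^esub>)\<rparr>"

lemma carrier_fsa_mult:
  assumes "f \<in> carrier (free_star_algebra G)" "g \<in> carrier (free_star_algebra G)"
  shows "f * g \<in> carrier (free_star_algebra G)"
  using assms keys_mult[of f g] by (fastforce simp: fsa_simps plus_star_word_def)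

lemma carrier_fsa_star:
  assumes "f \<in> carrier (free_star_algebra G)"
  shows "poly_star f \<in> carrier (free_star_algebra G)"
proof -
  have *: "fst ` set (letters (word_star w)) = fst ` set (letters w)" for w :: "'a star_word"
    by (force simp: word_star_def image_iff)
  show ?thesis unfolding fsa_simps
  proof (clarify)
    fix w a b assume "w \<in> Poly_Mapping.keys (poly_star f)" "(a, b) \<in> set (letters w)"
    moreover from this have "word_star w \<in> Poly_Mapping.keys f"
      by (simp add: in_keys_iff lookup_poly_star)
    ultimately show "fst (a, b) \<in> G"
      using assms *[of w] unfolding fsa_simps by blast
  qed
qed

lemma free_star_algebra: "complex_star_algebra (free_star_algebra G)"
proof -
  let ?A = "free_star_algebra G"
  have sub: "- f \<in> carrier ?A" if "f \<in> carrier ?A" for f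
    using that by (auto simp: fsa_simps)
  have add: "f + g \<in> carrier ?A" if "f \<in> carrier ?A" "g \<in> carrier ?A" for f g
    using that keys_add[of f g] by (fastforce simp: fsa_simps)
  have scale: "poly_scale c f \<in> carrier ?A" if "f \<in> carrier ?A" for f c
    using that keys_poly_scale[of c f] by (auto simp: fsa_simps)
  have one: "1 \<in> carrier ?A"
    by (auto simp: fsa_simps keys_one zero_star_word_def)
  have zero: "0 \<in> carrier ?A" by (simp add: fsa_simps)
  have ring: "ring ?A"
  proof (rule ringI)
    show "abelian_group ?A"
    proof (rule abelian_groupI)
      fix x assume "x \<in> carrier ?A"
      thus "\<exists>y\<in>carrier ?A. y \<oplus>\<^bsub>?A\<^esub> x = \<zero>\<^bsub>?A\<^esub>"
        using sub by (intro bexI[of _ "- x"]) (auto simp: fsa_simps)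
    qed (use add zero in \<open>auto simp: fsa_simps(2-) add_ac\<close>)
    show "Group.monoid ?A"
      by (rule monoidI) (use carrier_fsa_mult one in \<open>auto simp: fsa_simps(2-) mult.assoc\<close>)
  qed (auto simp: fsa_simps(2-) distrib_left distrib_right)
  interpret ring ?A by (rule ring)
  have module: "module (ring_of_type_algebra :: complex ring) ?A"
  proof (rule moduleI)
    show "cring (ring_of_type_algebra :: complex ring)" by (rule cring_from_type_algebra)
    show "abelian_group ?A" ..
  qed (use scale in \<open>auto simp: fsa_simps(2-) ring_of_type_algebra_def intro!: poly_mapping_eqI
      simp: lookup_poly_scale lookup_add algebra_simps\<close>)
  interpret module "ring_of_type_algebra :: complex ring" ?A by (rule module)
  show ?thesis
  proof
    fix c x y
    show "(c \<odot>\<^bsub>?A\<^esub> x) \<otimes>\<^bsub>?A\<^esub> y = c \<odot>\<^bsub>?A\<^esub> (x \<otimes>\<^bsub>?A\<^esub> y)"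
      by (simp add: fsa_simps(2-) poly_scale_mult mult.assoc)
    show "x \<otimes>\<^bsub>?A\<^esub> (c \<odot>\<^bsub>?A\<^esub> y) = c \<odot>\<^bsub>?A\<^esub> (x \<otimes>\<^bsub>?A\<^esub> y)"
      by (simp add: fsa_simps(2-) poly_scale_mult2 mult.assoc)
  qed (use carrier_fsa_star in \<open>auto simp: fsa_simps(2-) poly_star_star poly_star_add poly_star_mult
      intro!: poly_mapping_eqI simp: lookup_poly_star lookup_poly_scale\<close>)
qed

lemma (in complex_star_algebra) carrier_star_ideal: "star_ideal A (carrier A)"
  by (auto simp: star_ideal_def oneideal)

lemma (in complex_star_algebra) gen_star_ideal:
  assumes "S \<subseteq> carrier A"
  shows "star_ideal A (gen_star_ideal A S)" "S \<subseteq> gen_star_ideal A S"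
proof -
  let ?X = "{I. star_ideal A I \<and> S \<subseteq> I}"
  have "carrier A \<in> ?X" using carrier_star_ideal assms by auto
  hence "ideal (\<Inter>?X) A" by (intro i_Intersect) (auto simp: star_ideal_def)
  thus "star_ideal A (gen_star_ideal A S)"
    by (auto simp: star_ideal_def gen_star_ideal_def)
  show "S \<subseteq> gen_star_ideal A S" by (auto simp: gen_star_ideal_def)
qed

lemma (in complex_star_algebra) star_zero [simp]: "\<zero>\<^sup>\<star> = \<zero>"
proof -
  have "\<zero>\<^sup>\<star> \<oplus> \<zero>\<^sup>\<star> = \<zero>\<^sup>\<star> \<oplus> \<zero>"
    using star_add[of \<zero> \<zero>] by simp
  thus ?thesis by (metis add.l_cancel star_closed zero_closed)
qed

context complex_star_algebra
begin

lemma smult_in: "x \<in> carrier A \<Longrightarrow> c \<odot> x \<in> carrier A"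
  using scalar.smult_closed by (simp add: ring_of_type_algebra_def)

lemma smult_r: "x \<in> carrier A \<Longrightarrow> y \<in> carrier A \<Longrightarrow> c \<odot> (x \<oplus> y) = c \<odot> x \<oplus> c \<odot> y"
  using scalar.smult_r_distr by (simp add: ring_of_type_algebra_def)

lemma smult_l: "x \<in> carrier A \<Longrightarrow> (c + d) \<odot> x = c \<odot> x \<oplus> d \<odot> x"
  using scalar.smult_l_distr by (simp add: ring_of_type_algebra_def)

lemma smult_assoc: "x \<in> carrier A \<Longrightarrow> (c * d) \<odot> x = c \<odot> (d \<odot> x)"
  using scalar.smult_assoc1 by (simp add: ring_of_type_algebra_def)

lemma smult_1: "x \<in> carrier A \<Longrightarrow> 1 \<odot> x = x"
  using scalar.smult_one by (simp add: ring_of_type_algebra_def)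

lemma quot_unary:
  assumes "ideal I A" "x \<in> carrier A"
    and T: "\<And>x. x \<in> carrier A \<Longrightarrow> T x \<in> carrier A"
      "\<And>x y. x \<in> carrier A \<Longrightarrow> y \<in> carrier A \<Longrightarrow> T (x \<oplus> y) = T x \<oplus> T y"
      "\<And>x. x \<in> I \<Longrightarrow> T x \<in> I"
  shows "(\<Union>y\<in>I +> x. I +> T y) = I +> T x"
proof -
  interpret ideal I A by fact
  have "I +> T y = I +> T x" if y: "y \<in> I +> x" for y
  proof -
    obtain i where i: "i \<in> I" "y = i \<oplus> x" using y by (auto simp: a_r_coset_def')
    have "T y = T i \<oplus> T x" using i assms(2) T by (simp add: a_Hcarr)
    hence "T y \<in> I +> T x" using i T by (auto simp: a_r_coset_def')
    thus ?thesis using a_repr_independence'[OF _ T(1)[OF assms(2)]] by metis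
  qed
  moreover have "x \<in> I +> x" using assms(2) by (rule a_rcos_self)
  ultimately show ?thesis by blast
qed

lemma quot_simps:
  assumes I: "star_ideal A I"
  shows "carrier (quot_star_algebra A I) = (\<lambda>x. I +> x) ` carrier A"
    "x \<in> carrier A \<Longrightarrow> y \<in> carrier A \<Longrightarrow> (I +> x) \<otimes>\<^bsub>quot_star_algebra A I\<^esub> (I +> y) = I +> (x \<otimes> y)"
    "x \<in> carrier A \<Longrightarrow> y \<in> carrier A \<Longrightarrow> (I +> x) \<oplus>\<^bsub>quot_star_algebra A I\<^esub> (I +> y) = I +> (x \<oplus> y)"
    "\<one>\<^bsub>quot_star_algebra A I\<^esub> = I +> \<one>"
    "\<zero>\<^bsub>quot_star_algebra A I\<^esub> = I +> \<zero>"
    "x \<in> carrier A \<Longrightarrow> c \<odot>\<^bsub>quot_star_algebra A I\<^esub> (I +> x) = I +> (c \<odot> x)"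
    "x \<in> carrier A \<Longrightarrow> (I +> x)\<^sup>\<star>\<^bsub>quot_star_algebra A I\<^esub> = I +> x\<^sup>\<star>"
proof -
  interpret I: ideal I A using I by (simp add: star_ideal_def)
  show "carrier (quot_star_algebra A I) = (\<lambda>x. I +> x) ` carrier A"
    by (auto simp: quot_star_algebra_def FactRing_simps)
  show "(I +> x) \<otimes>\<^bsub>quot_star_algebra A I\<^esub> (I +> y) = I +> (x \<otimes> y)"
    if "x \<in> carrier A" "y \<in> carrier A"
    using that by (simp add: quot_star_algebra_def FactRing_def I.rcoset_mult_add)
  show "(I +> x) \<oplus>\<^bsub>quot_star_algebra A I\<^esub> (I +> y) = I +> (x \<oplus> y)"
    if "x \<in> carrier A" "y \<in> carrier A"
    using that by (simp add: quot_star_algebra_def FactRing_def I.a_rcos_sum)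
  show "\<one>\<^bsub>quot_star_algebra A I\<^esub> = I +> \<one>"
    by (simp add: quot_star_algebra_def FactRing_def)
  show "\<zero>\<^bsub>quot_star_algebra A I\<^esub> = I +> \<zero>"
    using I.a_rcos_const[of \<zero>] by (simp add: quot_star_algebra_def FactRing_def)
  have "c \<odot> i \<in> I" if "i \<in> I" for i
  proof -
    have i: "i \<in> carrier A" using that by (rule I.a_Hcarr)
    have "(c \<odot> \<one>) \<otimes> i = c \<odot> i" using i by (simp add: smult_mult_left)
    thus ?thesis using I.I_l_closed[OF that smult_in[OF one_closed]] by metis
  qed
  thus "c \<odot>\<^bsub>quot_star_algebra A I\<^esub> (I +> x) = I +> (c \<odot> x)" if "x \<in> carrier A"
    using quot_unary[OF I.ideal_axioms that, of "\<lambda>x. c \<odot> x"]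
    by (simp add: quot_star_algebra_def smult_in smult_r)
  show "(I +> x)\<^sup>\<star>\<^bsub>quot_star_algebra A I\<^esub> = I +> x\<^sup>\<star>" if "x \<in> carrier A"
    using quot_unary[OF I.ideal_axioms that, of "\<lambda>x. x\<^sup>\<star>"] I
    by (simp add: quot_star_algebra_def star_add star_ideal_def)
qed

lemma quot_star_algebra:
  assumes I: "star_ideal A I"
  shows "complex_star_algebra (quot_star_algebra A I)"
proof -
  interpret I: ideal I A using I by (simp add: star_ideal_def)
  let ?Q = "quot_star_algebra A I"
  note qs = quot_simps[OF I]
  have ring: "ring ?Q"
  proof (rule ringI)
    show "abelian_group ?Q"
    proof (rule abelian_groupI)
      fix C assume "C \<in> carrier ?Q"
      then obtain x where "x \<in> carrier A" "C = I +> x" by (auto simp: qs)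
      thus "\<exists>D\<in>carrier ?Q. D \<oplus>\<^bsub>?Q\<^esub> C = \<zero>\<^bsub>?Q\<^esub>"
        by (intro bexI[of _ "I +> (\<ominus> x)"]) (simp_all add: qs l_neg)
    qed (auto simp: qs a_ac)
    show "Group.monoid ?Q"
      by (rule monoidI) (auto simp: qs m_assoc)
  qed (auto simp: qs l_distr r_distr)
  interpret Q: ring ?Q by (rule ring)
  have module: "module (ring_of_type_algebra :: complex ring) ?Q"
  proof (rule moduleI)
    show "cring (ring_of_type_algebra :: complex ring)" by (rule cring_from_type_algebra)
    show "abelian_group ?Q" ..
  qed (auto simp: qs ring_of_type_algebra_def smult_in smult_r smult_l smult_assoc smult_1)
  interpret Q: module "ring_of_type_algebra :: complex ring" ?Q by (rule module)
  show ?thesis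
    by unfold_locales
      (auto simp: qs smult_in smult_mult_left smult_mult_right star_add star_smult star_mult)
qed

end

section \<open>Matrices over a ring\<close>

text \<open>An \<open>n \<times> n\<close> matrix is a function whose values matter only on \<open>{1..n} \<times> {1..n}\<close>.\<close>

type_synonym 'a mat_fun = "nat \<Rightarrow> nat \<Rightarrow> 'a"

definition mat_mult ::
    "('a, 'm) ring_scheme \<Rightarrow> nat \<Rightarrow> 'a mat_fun \<Rightarrow> 'a mat_fun \<Rightarrow> 'a mat_fun" where
  "mat_mult A n M N = (\<lambda>i j. \<Oplus>\<^bsub>A\<^esub>k\<in>{1..n}. M i k \<otimes>\<^bsub>A\<^esub> N k j)"

definition mat_one :: "('a, 'm) ring_scheme \<Rightarrow> 'a mat_fun" where
  "mat_one A = (\<lambda>i j. if i = j then \<one>\<^bsub>A\<^esub> else \<zero>\<^bsub>A\<^esub>)"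

primrec mat_pow :: "('a, 'm) ring_scheme \<Rightarrow> nat \<Rightarrow> 'a mat_fun \<Rightarrow> nat \<Rightarrow> 'a mat_fun" where
  "mat_pow A n M 0 = mat_one A"
| "mat_pow A n M (Suc p) = mat_mult A n (mat_pow A n M p) M"

definition mat_star :: "('a, 'm) star_algebra_scheme \<Rightarrow> 'a mat_fun \<Rightarrow> 'a mat_fun" where
  "mat_star A M = (\<lambda>i j. (M j i)\<^sup>\<star>\<^bsub>A\<^esub>)"

definition mat_trace :: "('a, 'm) ring_scheme \<Rightarrow> nat \<Rightarrow> 'a mat_fun \<Rightarrow> 'a" where
  "mat_trace A n M = (\<Oplus>\<^bsub>A\<^esub>i\<in>{1..n}. M i i)"

section \<open>The Brown algebra and the free Haar trace\<close>

definition brown_free :: "nat \<Rightarrow> (nat \<times> nat) star_poly star_algebra" where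
  "brown_free n = free_star_algebra ({1..n} \<times> {1..n})"

definition brown_relations :: "nat \<Rightarrow> (nat \<times> nat) star_poly set" where
  "brown_relations n =
     (let F = brown_free n; u = (\<lambda>i j. free_gen (i, j)) in
      (\<Union>i\<in>{1..n}. \<Union>j\<in>{1..n}.
        {mat_mult F n (mat_star F u) u i j \<ominus>\<^bsub>F\<^esub> mat_one F i j,
         mat_mult F n u (mat_star F u) i j \<ominus>\<^bsub>F\<^esub> mat_one F i j}))"

definition brown_ideal :: "nat \<Rightarrow> (nat \<times> nat) star_poly set" where
  "brown_ideal n = gen_star_ideal (brown_free n) (brown_relations n)"

definition brown :: "nat \<Rightarrow> (nat \<times> nat) star_poly set star_algebra" where
  "brown n = quot_star_algebra (brown_free n) (brown_ideal n)"

definition brown_u :: "nat \<Rightarrow> (nat \<times> nat) star_poly set mat_fun" where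
  "brown_u n = (\<lambda>i j. brown_ideal n +>\<^bsub>brown_free n\<^esub> free_gen (i, j))"

lemma brown_free: "complex_star_algebra (brown_free n)"
  by (simp add: brown_free_def free_star_algebra)

lemma free_gen_carrier: "g \<in> G \<Longrightarrow> free_gen g \<in> carrier (free_star_algebra G)"
  by (auto simp: fsa_simps free_gen_def)

lemma mat_mult_closed:
  assumes "ring A" "\<And>i j. i \<in> {1..n} \<Longrightarrow> j \<in> {1..n} \<Longrightarrow> M i j \<in> carrier A"
    "\<And>i j. i \<in> {1..n} \<Longrightarrow> j \<in> {1..n} \<Longrightarrow> N i j \<in> carrier A"
    "i \<in> {1..n}" "j \<in> {1..n}"
  shows "mat_mult A n M N i j \<in> carrier A"
proof -
  interpret ring A by fact
  show ?thesis using assms by (auto simp: mat_mult_def intro!: finsum_closed)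
qed

lemma brown_relations_carrier: "brown_relations n \<subseteq> carrier (brown_free n)"
proof -
  interpret F: complex_star_algebra "brown_free n" by (rule brown_free)
  have u: "free_gen (i, j) \<in> carrier (brown_free n)" if "i \<in> {1..n}" "j \<in> {1..n}" for i j
    using that by (auto simp: brown_free_def intro!: free_gen_carrier)
  have one: "mat_one (brown_free n) i j \<in> carrier (brown_free n)" for i j :: nat
    by (simp add: mat_one_def)
  show ?thesis
    unfolding brown_relations_def Let_def
    by (auto simp: mat_star_def intro!: F.minus_closed mat_mult_closed u one F.ring_axioms)
qed

lemma brown_ideal: "star_ideal (brown_free n) (brown_ideal n)" "brown_relations n \<subseteq> brown_ideal n"
proof -
  interpret F: complex_star_algebra "brown_free n" by (rule brown_free)
  show "star_ideal (brown_free n) (brown_ideal n)" "brown_relations n \<subseteq> brown_ideal n"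
    using F.gen_star_ideal[OF brown_relations_carrier] by (auto simp: brown_ideal_def)
qed

lemma brown: "complex_star_algebra (brown n)"
proof -
  interpret F: complex_star_algebra "brown_free n" by (rule brown_free)
  show ?thesis unfolding brown_def by (rule F.quot_star_algebra[OF brown_ideal(1)])
qed

lemma brown_u_closed: "i \<in> {1..n} \<Longrightarrow> j \<in> {1..n} \<Longrightarrow> brown_u n i j \<in> carrier (brown n)"
proof -
  interpret F: complex_star_algebra "brown_free n" by (rule brown_free)
  assume "i \<in> {1..n}" "j \<in> {1..n}"
  thus ?thesis unfolding brown_def F.quot_simps(1)[OF brown_ideal(1)] brown_u_def
    by (auto simp: brown_free_def intro!: imageI free_gen_carrier)
qed

lemma brown_unitary:
  assumes ij: "i \<in> {1..n}" "j \<in> {1..n}"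
  shows "mat_mult (brown n) n (mat_star (brown n) (brown_u n)) (brown_u n) i j = mat_one (brown n) i j"
    and "mat_mult (brown n) n (brown_u n) (mat_star (brown n) (brown_u n)) i j = mat_one (brown n) i j"
proof -
  let ?F = "brown_free n" and ?I = "brown_ideal n" and ?B = "brown n"
  let ?q = "\<lambda>x. ?I +>\<^bsub>?F\<^esub> x" and ?u = "\<lambda>i j. free_gen (i, j) :: (nat \<times> nat) star_poly"
  interpret F: complex_star_algebra ?F by (rule brown_free)
  interpret I: ideal ?I ?F using brown_ideal(1) by (simp add: star_ideal_def)
  interpret B: complex_star_algebra ?B by (rule brown)
  note qs = F.quot_simps[OF brown_ideal(1), folded brown_def]
  have u: "?u i j \<in> carrier ?F" if "i \<in> {1..n}" "j \<in> {1..n}" for i j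
    using that by (auto simp: brown_free_def intro!: free_gen_carrier)
  have hom: "?q \<in> ring_hom ?F ?B"
    by (rule ring_hom_memI) (auto simp: qs)
  interpret q: ring_hom_ring ?F ?B ?q
    by (rule ring_hom_ringI2[OF F.ring_axioms B.ring_axioms hom])
  have mm: "?q (mat_mult ?F n M N i j) = mat_mult ?B n (\<lambda>i j. ?q (M i j)) (\<lambda>i j. ?q (N i j)) i j"
    if "\<And>i j. i \<in> {1..n} \<Longrightarrow> j \<in> {1..n} \<Longrightarrow> M i j \<in> carrier ?F"
       "\<And>i j. i \<in> {1..n} \<Longrightarrow> j \<in> {1..n} \<Longrightarrow> N i j \<in> carrier ?F" for M N
  proof -
    have "?q (mat_mult ?F n M N i j) = (\<Oplus>\<^bsub>?B\<^esub>k\<in>{1..n}. ?q (M i k \<otimes>\<^bsub>?F\<^esub> N k j))"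
      unfolding mat_mult_def using that ij by (subst q.hom_finsum) (auto simp: comp_def)
    also have "\<dots> = mat_mult ?B n (\<lambda>i j. ?q (M i j)) (\<lambda>i j. ?q (N i j)) i j"
      unfolding mat_mult_def using that ij by (intro B.finsum_cong') auto
    finally show ?thesis .
  qed
  have one: "?q (mat_one ?F i j) = mat_one ?B i j" by (simp add: mat_one_def)
  have eq: "?q x = ?q y" if "x \<ominus>\<^bsub>?F\<^esub> y \<in> ?I" "x \<in> carrier ?F" "y \<in> carrier ?F" for x y
    using F.quotient_eq_iff_same_a_r_cos[OF I.ideal_axioms] that by blast
  have oc: "mat_one ?F i j \<in> carrier ?F" by (simp add: mat_one_def)
  have sc: "mat_star ?F ?u i j \<in> carrier ?F" if "i \<in> {1..n}" "j \<in> {1..n}" for i j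
    using u that by (simp add: mat_star_def)
  have st: "mat_mult ?B n (\<lambda>i j. ?q (mat_star ?F ?u i j)) (brown_u n) i j =
      mat_mult ?B n (mat_star ?B (brown_u n)) (brown_u n) i j"
     "mat_mult ?B n (brown_u n) (\<lambda>i j. ?q (mat_star ?F ?u i j)) i j =
      mat_mult ?B n (brown_u n) (mat_star ?B (brown_u n)) i j"
  proof -
    have q_star: "?q (mat_star ?F ?u k l) = mat_star ?B (brown_u n) k l"
      "mat_star ?B (brown_u n) k l \<in> carrier ?B"
      if "k \<in> {1..n}" "l \<in> {1..n}" for k l
      using u[OF that(2,1)] brown_u_closed[OF that(2,1)]
      by (simp_all add: mat_star_def brown_u_def qs(7))
    show "mat_mult ?B n (\<lambda>i j. ?q (mat_star ?F ?u i j)) (brown_u n) i j =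
        mat_mult ?B n (mat_star ?B (brown_u n)) (brown_u n) i j"
      unfolding mat_mult_def
      by (intro B.finsum_cong' Pi_I B.m_closed) (simp_all add: q_star ij brown_u_closed del: atLeastAtMost_iff One_nat_def)
    show "mat_mult ?B n (brown_u n) (\<lambda>i j. ?q (mat_star ?F ?u i j)) i j =
        mat_mult ?B n (brown_u n) (mat_star ?B (brown_u n)) i j"
      unfolding mat_mult_def
      by (intro B.finsum_cong' Pi_I B.m_closed) (simp_all add: q_star ij brown_u_closed del: atLeastAtMost_iff One_nat_def)
  qed
  have rel: "mat_mult ?F n (mat_star ?F ?u) ?u i j \<ominus>\<^bsub>?F\<^esub> mat_one ?F i j \<in> ?I"
     "mat_mult ?F n ?u (mat_star ?F ?u) i j \<ominus>\<^bsub>?F\<^esub> mat_one ?F i j \<in> ?I"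
    using brown_ideal(2)[of n] ij unfolding brown_relations_def Let_def by blast+
  show "mat_mult ?B n (mat_star ?B (brown_u n)) (brown_u n) i j = mat_one ?B i j"
    using eq[OF rel(1) mat_mult_closed[OF F.ring_axioms sc u ij] oc] mm[of "mat_star ?F ?u" ?u, OF sc u] st one
    by (simp add: brown_u_def)
  show "mat_mult ?B n (brown_u n) (mat_star ?B (brown_u n)) i j = mat_one ?B i j"
    using eq[OF rel(2) mat_mult_closed[OF F.ring_axioms u sc ij] oc] mm[of ?u "mat_star ?F ?u", OF u sc] st one
    by (simp add: brown_u_def)
qed

definition brown_entry :: "nat \<Rightarrow> bool \<Rightarrow> (nat \<times> nat) star_poly set mat_fun" where
  "brown_entry n e = (if e then mat_star (brown n) (brown_u n) else brown_u n)"

definition brown_chi :: "nat \<Rightarrow> nat \<Rightarrow> (nat \<times> nat) star_poly set" where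
  "brown_chi n p = mat_trace (brown n) n (mat_pow (brown n) n (brown_u n) p)"

text \<open>The moment-cumulant formula reduces the value of such a functional on every word in the
  entries of \<open>u\<close> and \<open>u\<^sup>*\<close> to the prescribed cumulants, so it is unique.\<close>

definition free_haar_trace ::
    "nat \<Rightarrow> ((nat \<times> nat) star_poly set \<Rightarrow> complex) \<Rightarrow> bool" where
  "free_haar_trace n h \<longleftrightarrow>
     unital_linear_functional (brown n) h \<and>
     (\<forall>r\<ge>1. \<forall>i j \<epsilon>. (\<forall>l\<in>{1..r}. i l \<in> {1..n} \<and> j l \<in> {1..n}) \<longrightarrow>
        free_cumulant (brown n) h (map (\<lambda>l. brown_entry n (\<epsilon> l) (i l) (j l)) [1..<Suc r]) =
        (if (\<forall>l\<in>{2..r}. j (l - 1) = i l) \<and> j r = i 1 \<and> even r \<and>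
            (\<forall>l\<in>{1..<r}. \<epsilon> l \<noteq> \<epsilon> (l + 1))
         then of_nat n powi (1 - int r) * (-1) ^ (r div 2 - 1) *
           (let m = r div 2 - 1 in fact (2 * m) / (fact (m + 1) * fact m))
         else 0))"

section \<open>Circular families and convergence in joint star-distribution\<close>

definition free_circular_family ::
    "('a, 'm) star_algebra_scheme \<Rightarrow> ('a \<Rightarrow> complex) \<Rightarrow> (nat \<Rightarrow> 'a) \<Rightarrow> bool" where
  "free_circular_family A \<phi> c \<longleftrightarrow>
     (\<forall>p\<ge>1. c p \<in> carrier A) \<and>
     (\<forall>r\<ge>1. \<forall>p e. (\<forall>l\<in>{1..r}. p l \<ge> 1) \<longrightarrow>
        free_cumulant A \<phi> (map (\<lambda>l. star_if A (e l) (c (p l))) [1..<Suc r]) =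
        (if r = 2 \<and> p 1 = p 2 \<and> e 1 \<noteq> e 2 then 1 else 0))"

definition joint_star_moment ::
    "('a, 'm) star_algebra_scheme \<Rightarrow> ('a \<Rightarrow> complex) \<Rightarrow> (nat \<Rightarrow> 'a) \<Rightarrow>
     nat \<Rightarrow> (nat \<Rightarrow> nat) \<Rightarrow> (nat \<Rightarrow> bool) \<Rightarrow> complex" where
  "joint_star_moment A \<phi> a s p e =
     \<phi> (list_mult A (map (\<lambda>l. star_if A (e l) (a (p l))) [1..<Suc s]))"

definition converges_in_star_distribution ::
    "(nat \<Rightarrow> ('a, 'm) star_algebra_scheme) \<Rightarrow> (nat \<Rightarrow> 'a \<Rightarrow> complex) \<Rightarrow> (nat \<Rightarrow> nat \<Rightarrow> 'a) \<Rightarrow>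
     ('b, 'k) star_algebra_scheme \<Rightarrow> ('b \<Rightarrow> complex) \<Rightarrow> (nat \<Rightarrow> 'b) \<Rightarrow> bool" where
  "converges_in_star_distribution A \<phi> a B \<psi> b \<longleftrightarrow>
     (\<forall>s\<ge>1. \<forall>p e. (\<forall>l\<in>{1..s}. p l \<ge> 1) \<longrightarrow>
        (\<lambda>n. joint_star_moment (A n) (\<phi> n) (a n) s p e) \<longlonglongrightarrow> joint_star_moment B \<psi> b s p e)"

end

theory Submission
  imports Defs
begin

text \<open>Expanding all traces turns a moment into a sum over index lists of length \<open>N\<close> (the sum of
  the exponents) and over \<open>P \<in> NC N\<close>. Only partitions whose blocks alternate between \<open>u\<close> and
  \<open>u\<^sup>*\<close> contribute, so every block is even and \<open>card P \<le> N / 2\<close>. The nonzero terms are the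
  index lists that are constant on the cycles of a permutation which also exchanges the positions
  of \<open>u\<close> and of \<open>u\<^sup>*\<close>; there are at most \<open>n ^ (N / 2)\<close> of those. Hence the
  contribution \<open>O(n ^ (N / 2) * n ^ (card P - N))\<close> survives in the limit only if \<open>P\<close> is a pairing
  and the permutation is an involution, and it is then 1. Such a pairing matches whole
  factors of equal exponent and opposite star in reverse order, so these \<open>P\<close> correspond to
  the noncrossing pairings counted by the moment of the circular family.\<close>

section \<open>Cyclic successors\<close>

text \<open>The covariance is 1 because of noncrossingness. For the permutation \<open>q\<close> of
  a pairing and the cyclic shift \<open>rot\<close> inside each factor, the involution condition
  reads \<open>rot o q o rot = q\<close>. Between two factors of length p it is solved by the p
  reflections k -> c - k mod p, and only c = p - 1, the nested arches, is noncrossing. For classical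
  Haar unitary matrices all p reflections survive at leading order, whence the variance p there. The
  two bounds by N / 2, on the number of blocks and on the number of free indices, both come from the
  exchange of colours but are treated independently: missing either one costs at least one power of
  n. The signed Catalan numbers enter as constants independent of n, with value 1 on pairs.\<close>

lemma nths_map_upt:
  assumes "V \<subseteq> {..<N}"
  shows "nths (map f [0..<N]) V = map f (sorted_list_of_set V)"
proof -
  have "set (nths [0..<N] V) = V" using assms by (force simp: set_nths)
  moreover have "sorted (nths [0..<N] V)" "distinct (nths [0..<N] V)"
    by (auto intro: sorted_nths distinct_nthsI)
  ultimately have "nths [0..<N] V = sorted_list_of_set V"
    by (metis sorted_list_of_set.idem_if_sorted_distinct)
  thus ?thesis by (simp add: nths_map)
qed

text \<open>The index condition of a Haar cumulant links each letter of a block with the next and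
  the last with the first; this is that link, on positions. The definite description inverts the
  enumeration of \<open>V\<close>, which has no repetitions.\<close>

definition cyc_next :: "nat set \<Rightarrow> nat \<Rightarrow> nat" where
  "cyc_next V v = (let xs = sorted_list_of_set V in
     xs ! (Suc (THE l. l < length xs \<and> xs ! l = v) mod length xs))"

lemma cyc_next_nth:
  assumes "finite V" "l < card V"
  shows "cyc_next V (sorted_list_of_set V ! l) = sorted_list_of_set V ! (Suc l mod card V)"
proof -
  let ?xs = "sorted_list_of_set V"
  have "(THE k. k < length ?xs \<and> ?xs ! k = ?xs ! l) = l"
    using assms by (intro the_equality) (auto simp: nth_eq_iff_index_eq)
  thus ?thesis by (simp add: cyc_next_def)
qed

lemma ball_sorted_list_of_set:
  assumes "finite V"
  shows "(\<forall>v\<in>V. Q v) \<longleftrightarrow> (\<forall>l<card V. Q (sorted_list_of_set V ! l))"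
  using assms by (metis in_set_conv_nth length_sorted_list_of_set set_sorted_list_of_set)

lemma Suc_mod_inj:
  assumes "Suc k mod r = Suc l mod r" "k < r" "l < r"
  shows "k = l"
  using assms by (cases "Suc k = r"; cases "Suc l = r") auto

lemma bij_cyc_next:
  assumes "finite V"
  shows "bij_betw (cyc_next V) V V"
proof -
  let ?xs = "sorted_list_of_set V" and ?r = "card V"
  have b: "bij_betw (\<lambda>l. ?xs ! l) {..<?r} V"
    using assms by (intro bij_betw_nth) auto
  have "inj_on (\<lambda>l. Suc l mod ?r) {..<?r}"
    by (rule inj_onI) (auto dest: Suc_mod_inj)
  moreover have "(\<lambda>l. Suc l mod ?r) ` {..<?r} \<subseteq> {..<?r}"
    by auto
  ultimately have c: "bij_betw (\<lambda>l. Suc l mod ?r) {..<?r} {..<?r}"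
    by (simp add: bij_betw_def endo_inj_surj)
  have "bij_betw (\<lambda>l. cyc_next V (?xs ! l)) {..<?r} V"
    using bij_betw_trans[OF c b] cyc_next_nth[OF assms]
    by (subst bij_betw_cong[where g = "(\<lambda>l. ?xs ! l) \<circ> (\<lambda>l. Suc l mod ?r)"]) auto
  thus ?thesis using bij_betw_comp_iff[OF b, of "cyc_next V" V] by (simp add: comp_def)
qed

text \<open>Rotating a list of length 2 swaps its entries. This makes \<open>part_next\<close> of a
  pairing an involution.\<close>

lemma cyc_next_pair:
  assumes "v \<noteq> w"
  shows "cyc_next {v, w} v = w"
proof -
  have *: "cyc_next {v, w} v = w \<and> cyc_next {v, w} w = v" if "v < w" for v w
  proof -
    have "sorted_list_of_set {v, w} = [v, w]"
      using that by (simp add: sorted_list_of_set_insert_remove insort_remove1)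
    thus ?thesis
      using cyc_next_nth[of "{v, w}" 0] cyc_next_nth[of "{v, w}" 1] that by auto
  qed
  show ?thesis
    using *[of v w] *[of w v] assms by (cases "v < w") (auto simp: insert_commute)
qed

section \<open>Partitions as permutations\<close>

definition block_of :: "'a set set \<Rightarrow> 'a \<Rightarrow> 'a set" where
  "block_of P v = (THE V. V \<in> P \<and> v \<in> V)"

lemma block_of_eq:
  assumes "partition_on I P" "V \<in> P" "v \<in> V"
  shows "block_of P v = V"
  unfolding block_of_def
  using assms by (intro the_equality) (auto simp: partition_on_def disjoint_def)

text \<open>Biane's permutation of a partition: its cycles are the blocks, each run through in
  increasing order.\<close>

definition part_next :: "nat set set \<Rightarrow> nat \<Rightarrow> nat" where
  "part_next P v = cyc_next (block_of P v) v"

lemma part_next_eq: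
  assumes "partition_on I P" "V \<in> P" "v \<in> V"
  shows "part_next P v = cyc_next V v"
  using block_of_eq[OF assms] by (simp add: part_next_def)

lemma partition_on_finite:
  assumes "partition_on I P" "finite I"
  shows "finite P" "\<And>V. V \<in> P \<Longrightarrow> finite V"
proof -
  show "finite P" using assms finite_elements by blast
  show "finite V" if "V \<in> P" for V
    using that assms by (metis Union_upper finite_subset partition_onD1)
qed

lemma bij_part_next:
  assumes P: "partition_on I P" and "finite I"
  shows "bij_betw (part_next P) I I"
proof -
  note fin = partition_on_finite(2)[OF assms]
  have "part_next P ` V = V" if "V \<in> P" for V
  proof -
    have "part_next P ` V = cyc_next V ` V"
      using part_next_eq[OF P that] by simp
    thus ?thesis using bij_cyc_next[OF fin[OF that]] by (simp add: bij_betw_def)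
  qed
  hence "part_next P ` \<Union>P = \<Union>P" by (simp add: image_Union)
  hence "part_next P ` I = I" using P by (simp add: partition_on_def)
  thus ?thesis using \<open>finite I\<close> by (simp add: bij_betw_def eq_card_imp_inj_on)
qed

section \<open>Counting colour-compatible index lists\<close>

text \<open>Lists, because the indices of a product of traces are the concatenation of those of its
  factors.\<close>

definition index_lists :: "nat \<Rightarrow> nat \<Rightarrow> nat list set" where
  "index_lists n N = {xs. set xs \<subseteq> {1..n} \<and> length xs = N}"

lemma finite_index_lists: "finite (index_lists n N)"
  unfolding index_lists_def by (rule finite_lists_length_eq) simp

lemma index_lists_nth: "xs \<in> index_lists n N \<Longrightarrow> v < N \<Longrightarrow> xs ! v \<in> {1..n}"
  unfolding index_lists_def using nth_mem by blast

text \<open>As \<tau> permutes \<open>I\<close> and negates the colour, the preimage of a position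
  of one colour has the other; so \<tau> restricts to a bijection between the colour
  classes.\<close>

lemma card_swap_half:
  assumes "finite I" "bij_betw \<tau> I I" "\<And>v. v \<in> I \<Longrightarrow> \<epsilon> (\<tau> v) = (\<not> \<epsilon> v)"
  shows "card I = 2 * card {v \<in> I. \<epsilon> v}"
proof -
  have "\<tau> ` {v \<in> I. \<epsilon> v} = {v \<in> I. \<not> \<epsilon> v}"
  proof (intro equalityI subsetI)
    fix w assume w: "w \<in> {v \<in> I. \<not> \<epsilon> v}"
    then obtain v where "v \<in> I" "w = \<tau> v" using assms(2) by (auto simp: bij_betw_def)
    thus "w \<in> \<tau> ` {v \<in> I. \<epsilon> v}" using assms(3) w by auto
  next
    fix w assume "w \<in> \<tau> ` {v \<in> I. \<epsilon> v}"
    thus "w \<in> {v \<in> I. \<not> \<epsilon> v}" using assms(2,3) by (auto simp: bij_betw_def)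
  qed
  moreover have "inj_on \<tau> {v \<in> I. \<epsilon> v}"
    using assms(2) by (auto simp: bij_betw_def inj_on_def)
  ultimately have "card {v \<in> I. \<not> \<epsilon> v} = card {v \<in> I. \<epsilon> v}"
    by (metis card_image)
  moreover have "card I = card {v \<in> I. \<epsilon> v} + card {v \<in> I. \<not> \<epsilon> v}"
    using assms(1) by (subst card_Un_disjoint[symmetric]) (auto intro: arg_cong[of _ _ card])
  ultimately show ?thesis by simp
qed

definition inv_lists :: "nat \<Rightarrow> (nat \<Rightarrow> nat) \<Rightarrow> nat \<Rightarrow> nat list set" where
  "inv_lists N \<tau> n = {xs \<in> index_lists n N. \<forall>v<N. xs ! \<tau> v = xs ! v}"

context
  fixes N :: nat and \<tau> :: "nat \<Rightarrow> nat" and \<epsilon> :: "nat \<Rightarrow> bool"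
  assumes bij: "bij_betw \<tau> {..<N} {..<N}"
    and swap: "\<And>v. v < N \<Longrightarrow> \<epsilon> (\<tau> v) = (\<not> \<epsilon> v)"
begin

lemma tau_less: "v < N \<Longrightarrow> \<tau> v < N"
  using bij by (auto simp: bij_betw_def)

text \<open>An invariant list is determined by its entries at the positions \<open>v\<close> with \<open>\<epsilon> v\<close>, as \<open>\<tau>\<close>
  maps all other positions to those.\<close>

lemma card_inv_lists_le_aux:
  assumes "T \<subseteq> {..<N}"
    and det: "\<And>xs v. xs \<in> inv_lists N \<tau> n \<Longrightarrow> v < N \<Longrightarrow> \<epsilon> v \<Longrightarrow> \<exists>t\<in>T. \<forall>xs\<in>inv_lists N \<tau> n. xs ! v = xs ! t"
  shows "card (inv_lists N \<tau> n) \<le> n ^ card T"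
proof -
  let ?f = "\<lambda>xs. restrict ((!) xs) T"
  have fT: "finite T" using assms(1) finite_subset by blast
  have "inj_on ?f (inv_lists N \<tau> n)"
  proof (rule inj_onI)
    fix xs ys assume xs: "xs \<in> inv_lists N \<tau> n" and ys: "ys \<in> inv_lists N \<tau> n" and eq: "?f xs = ?f ys"
    have T: "xs ! t = ys ! t" if "t \<in> T" for t using fun_cong[OF eq, of t] that by simp
    have 1: "xs ! v = ys ! v" if "v < N" "\<epsilon> v" for v
      using det[OF xs that] T xs ys by metis
    have "xs ! v = ys ! v" if "v < N" for v
    proof (cases "\<epsilon> v")
      case False
      hence "xs ! \<tau> v = ys ! \<tau> v" using 1 swap tau_less that by blast
      thus ?thesis using xs ys that by (simp add: inv_lists_def)
    qed (use 1 that in blast)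
    thus "xs = ys" using xs ys by (auto simp: inv_lists_def index_lists_def intro: nth_equalityI)
  qed
  moreover have "?f ` inv_lists N \<tau> n \<subseteq> T \<rightarrow>\<^sub>E {1..n}"
    using assms(1) index_lists_nth[of _ n N]
    by (auto simp: inv_lists_def subset_iff simp del: atLeastAtMost_iff)
  ultimately have "card (inv_lists N \<tau> n) \<le> card (T \<rightarrow>\<^sub>E {1..n})"
    using fT by (intro card_inj_on_le) (auto intro: finite_PiE)
  thus ?thesis by (simp add: card_PiE[OF fT])
qed

lemma card_inv_lists_le: "card (inv_lists N \<tau> n) \<le> n ^ (N div 2)"
proof -
  have "N div 2 = card {v \<in> {..<N}. \<epsilon> v}"
    using card_swap_half[OF _ bij, of \<epsilon>] swap by simp
  moreover have "card (inv_lists N \<tau> n) \<le> n ^ card {v \<in> {..<N}. \<epsilon> v}"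
    by (rule card_inv_lists_le_aux) auto
  ultimately show ?thesis by simp
qed

text \<open>A position moved by the square of \<tau> shares its cycle with a different position of
  the same colour. Invariant lists take equal values at both, so one of the \<open>N div 2\<close>
  free entries is lost.\<close>

lemma card_inv_lists_less:
  assumes "v < N" "\<tau> (\<tau> v) \<noteq> v"
  shows "card (inv_lists N \<tau> n) \<le> n ^ (N div 2 - 1)"
proof -
  \<comment> \<open>The moved position may have the wrong colour; then \<open>\<tau> v\<close> has
    the right one, and it is moved as well because \<tau> is injective.\<close>
  obtain t where t: "t < N" "\<tau> (\<tau> t) \<noteq> t" "\<epsilon> t"
  proof (cases "\<epsilon> v")
    case True
    thus ?thesis using that assms by blast
  next
    case False
    have "\<tau> (\<tau> (\<tau> v)) \<noteq> \<tau> v"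
      using bij assms tau_less by (meson bij_betw_imp_inj_on inj_on_eq_iff lessThan_iff)
    thus ?thesis using that[of "\<tau> v"] False swap[OF assms(1)] tau_less assms by blast
  qed
  let ?T = "{v \<in> {..<N}. \<epsilon> v}"
  have "N div 2 = card ?T"
    using card_swap_half[OF _ bij, of \<epsilon>] swap by simp
  moreover have "card (inv_lists N \<tau> n) \<le> n ^ card (?T - {t})"
  proof (rule card_inv_lists_le_aux)
    fix xs v assume "v < N" "\<epsilon> v"
    show "\<exists>u\<in>?T - {t}. \<forall>xs\<in>inv_lists N \<tau> n. xs ! v = xs ! u"
    proof (cases "v = t")
      case True
      have "xs ! v = xs ! \<tau> (\<tau> v)" if "xs \<in> inv_lists N \<tau> n" for xs
        using that \<open>v < N\<close> tau_less by (simp add: inv_lists_def)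
      moreover have "\<tau> (\<tau> v) \<in> ?T - {t}"
        using True t tau_less swap by simp
      ultimately show ?thesis by blast
    qed (use \<open>v < N\<close> \<open>\<epsilon> v\<close> in auto)
  qed auto
  ultimately show ?thesis using t by simp
qed

text \<open>When all cycles have length 2, values chosen freely at the positions of one colour
  extend to an invariant list by copying each to its partner. This is the lower bound.\<close>

lemma card_inv_lists_eq:
  assumes invol: "\<And>v. v < N \<Longrightarrow> \<tau> (\<tau> v) = v"
  shows "card (inv_lists N \<tau> n) = n ^ (N div 2)"
proof (rule antisym[OF card_inv_lists_le])
  let ?T = "{v \<in> {..<N}. \<epsilon> v}"
  let ?f = "\<lambda>g. map (\<lambda>v. if \<epsilon> v then g v else g (\<tau> v)) [0..<N] :: nat list"
  have half: "N div 2 = card ?T"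
    using card_swap_half[OF _ bij, of \<epsilon>] swap by simp
  have "inj_on ?f (?T \<rightarrow>\<^sub>E {1..n})"
  proof (rule inj_onI)
    fix g g' assume g: "g \<in> ?T \<rightarrow>\<^sub>E {1..n}" "g' \<in> ?T \<rightarrow>\<^sub>E {1..n}" and eq: "?f g = ?f g'"
    have "g v = g' v" if "v \<in> ?T" for v
      using arg_cong[OF eq, of "\<lambda>xs. xs ! v"] that by simp
    thus "g = g'" using g by (intro PiE_ext) auto
  qed
  moreover have "?f g \<in> inv_lists N \<tau> n" if "g \<in> ?T \<rightarrow>\<^sub>E {1..n}" for g
  proof -
    have "g v \<in> {1..n}" if "v < N" "\<epsilon> v" for v
      using that \<open>g \<in> _\<close> by (intro PiE_mem[of g ?T]) auto
    thus ?thesis using tau_less swap invol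
      unfolding inv_lists_def index_lists_def by (auto simp del: atLeastAtMost_iff)
  qed
  ultimately have "card (?T \<rightarrow>\<^sub>E {1..n}) \<le> card (inv_lists N \<tau> n)"
    using finite_index_lists[of n N] by (intro card_inj_on_le[of ?f]) (auto simp: inv_lists_def)
  thus "n ^ (N div 2) \<le> card (inv_lists N \<tau> n)"
    by (simp add: card_PiE half)
qed

end

section \<open>Noncrossing pairings as involutions\<close>

definition NC2 :: "nat \<Rightarrow> nat set set set" where
  "NC2 s = {P \<in> NC s. \<forall>V\<in>P. card V = 2}"

lemma NC_no_crossing:
  assumes "P \<in> NC s" "V \<in> P" "W \<in> P" "a \<in> V" "c \<in> V" "b \<in> W" "d \<in> W"
    "a < b" "b < c" "c < d"
  shows "V = W"
proof -
  have "\<forall>V\<in>P. \<forall>W\<in>P. V \<noteq> W \<longrightarrow>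
     \<not> (\<exists>a b c d. a < b \<and> b < c \<and> c < d \<and> a \<in> V \<and> c \<in> V \<and> b \<in> W \<and> d \<in> W)"
    using assms(1) unfolding NC_def by (elim CollectE conjE)
  from this[rule_format, OF assms(2,3)] show ?thesis using assms by metis
qed

text \<open>Functions rather than set partitions, so that they can be composed with the shift inside
  the factors. Two members of one pair are \<open>v\<close> and \<open>f v\<close>, which leaves the
  chain in the second clause as the only crossing pattern. Values at arguments from \<open>s\<close>
  on are left open.\<close>

definition nc_invol :: "nat \<Rightarrow> (nat \<Rightarrow> nat) \<Rightarrow> bool" where
  "nc_invol s f \<longleftrightarrow> (\<forall>v<s. f v < s \<and> f v \<noteq> v \<and> f (f v) = v) \<and>
     (\<forall>v w. v < w \<and> w < f v \<and> f v < f w \<longrightarrow> \<not> w < s)"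

definition pairs_of :: "nat \<Rightarrow> (nat \<Rightarrow> nat) \<Rightarrow> nat set set" where
  "pairs_of s f = (\<lambda>v. {v, f v}) ` {..<s}"

lemma pairs_of_cong: "(\<And>v. v < s \<Longrightarrow> f v = g v) \<Longrightarrow> pairs_of s f = pairs_of s g"
  unfolding pairs_of_def by (intro image_cong) auto

lemma pairs_of_meet:
  assumes "nc_invol s f" "V \<in> pairs_of s f" "v \<in> V"
  shows "V = {v, f v}" "v < s"
  using assms by (auto simp: pairs_of_def nc_invol_def)

lemma pairs_of_partition:
  assumes "nc_invol s f"
  shows "partition_on {..<s} (pairs_of s f)"
proof (rule partition_onI)
  show "\<Union>(pairs_of s f) = {..<s}"
    using assms by (auto simp: pairs_of_def nc_invol_def)
  show "disjnt V W" if "V \<in> pairs_of s f" "W \<in> pairs_of s f" "V \<noteq> W" for V W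
    using pairs_of_meet(1)[OF assms] that unfolding disjnt_def by (metis disjoint_iff)
qed (auto simp: pairs_of_def)

lemma pairs_of_in_NC2:
  assumes f: "nc_invol s f"
  shows "pairs_of s f \<in> NC2 s"
proof -
  have "\<not> (a < b \<and> b < c \<and> c < d \<and> a \<in> V \<and> c \<in> V \<and> b \<in> W \<and> d \<in> W)"
    if "V \<in> pairs_of s f" "W \<in> pairs_of s f" for V W and a b c d
  proof
    assume *: "a < b \<and> b < c \<and> c < d \<and> a \<in> V \<and> c \<in> V \<and> b \<in> W \<and> d \<in> W"
    hence "V = {a, f a}" "W = {b, f b}" "b < s" using pairs_of_meet[OF f] that by blast+
    hence "c = f a" "d = f b" using * by auto
    thus False using f * \<open>b < s\<close> unfolding nc_invol_def by blast
  qed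
  moreover have "card V = 2" if "V \<in> pairs_of s f" for V
    using that f by (auto simp: pairs_of_def nc_invol_def card_2_iff)
  ultimately show ?thesis
    using pairs_of_partition[OF f] unfolding NC2_def NC_def mem_Collect_eq by blast
qed

lemma part_next_pairs_of:
  assumes f: "nc_invol s f" and v: "v < s"
  shows "part_next (pairs_of s f) v = f v"
proof -
  have "part_next (pairs_of s f) v = cyc_next {v, f v} v"
    using v by (intro part_next_eq[OF pairs_of_partition[OF f]]) (auto simp: pairs_of_def)
  also have "\<dots> = f v" using f v by (intro cyc_next_pair) (auto simp: nc_invol_def)
  finally show ?thesis .
qed

lemma pairing_block:
  assumes P: "partition_on I P" "\<forall>V\<in>P. card V = 2" and V: "V \<in> P" "v \<in> V"
  shows "V = {v, part_next P v}" "part_next P v \<noteq> v"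
proof -
  obtain x y where "V = {x, y}" "x \<noteq> y" using P(2) V(1) by (metis card_2_iff)
  then obtain w where w: "V = {v, w}" "w \<noteq> v" using V(2) by (cases "v = x") auto
  have "part_next P v = w"
    using part_next_eq[OF P(1) V] cyc_next_pair[of v w] w by simp
  thus "V = {v, part_next P v}" "part_next P v \<noteq> v" using w by simp_all
qed

text \<open>With \<open>part_next_pairs_of\<close> this makes \<open>part_next\<close> and
  \<open>pairs_of\<close> mutually inverse between noncrossing pairings and noncrossing involutions,
  the latter up to their values from \<open>s\<close> on.\<close>

lemma NC2_invol:
  assumes P: "P \<in> NC2 s"
  shows "nc_invol s (part_next P)" "pairs_of s (part_next P) = P"
proof -
  have part: "partition_on {..<s} P" and two: "\<forall>V\<in>P. card V = 2"
    using P by (auto simp: NC2_def NC_def)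
  note bl = pairing_block[OF part two]
  have ex: "{v, part_next P v} \<in> P" "part_next P v \<noteq> v" "part_next P v < s" if "v < s" for v
  proof -
    have "v \<in> \<Union>P" using that unfolding partition_onD1[OF part, symmetric] by simp
    then obtain V where V: "V \<in> P" "v \<in> V" by blast
    show "{v, part_next P v} \<in> P" using bl(1)[OF V] V(1) by metis
    show "part_next P v \<noteq> v" by (rule bl(2)[OF V])
    show "part_next P v < s"
      using \<open>{v, part_next P v} \<in> P\<close> partition_onD1[OF part] by blast
  qed
  have inv: "part_next P (part_next P v) = v" if "v < s" for v
  proof -
    have "{v, part_next P v} = {part_next P v, part_next P (part_next P v)}"
      by (rule bl(1)[OF ex(1)[OF that]]) simp
    thus ?thesis by (auto simp: doubleton_eq_iff)
  qed
  have nc: "\<not> w < s" if c: "v < w \<and> w < part_next P v \<and> part_next P v < part_next P w" for v w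
  proof
    assume "w < s"
    hence "{v, part_next P v} \<in> P" "{w, part_next P w} \<in> P" using ex c by auto
    hence "{v, part_next P v} = {w, part_next P w}"
      using NC_no_crossing[of P s _ _ v "part_next P v" w "part_next P w"] P c
      by (simp add: NC2_def)
    thus False using c by (auto simp: doubleton_eq_iff)
  qed
  show "nc_invol s (part_next P)" unfolding nc_invol_def using ex inv nc by blast
  show "pairs_of s (part_next P) = P"
  proof
    show "pairs_of s (part_next P) \<subseteq> P" using ex by (auto simp: pairs_of_def)
    show "P \<subseteq> pairs_of s (part_next P)"
    proof
      fix V assume V: "V \<in> P"
      then obtain v where v: "v \<in> V" using two by fastforce
      hence "v < s" using partition_onD1[OF part] V by blast
      thus "V \<in> pairs_of s (part_next P)"
        unfolding pairs_of_def using bl(1)[OF V v] by (intro image_eqI[where x = v]) simp_all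
    qed
  qed
qed

section \<open>Words in powers\<close>

text \<open>In the expansion of \<open>\<chi>(u\<^bsup>p 0\<^esup>) \<chi>(u\<^bsup>p 1\<^esup>) \<cdots>\<close>, position \<open>v\<close> belongs to the factor
  \<open>slot v\<close>, and the second index at \<open>v\<close> is the first index at \<open>rot v\<close>.\<close>

locale power_word =
  fixes p :: "nat \<Rightarrow> nat" and e :: "nat \<Rightarrow> bool"
  assumes p_pos: "p l \<ge> 1"
begin

section \<open>Positions and the factors containing them\<close>

definition "offset l = sum p {..<l}"

definition "slot v = (LEAST l. v < offset (Suc l))"

definition "rot v = offset (slot v) + Suc (v - offset (slot v)) mod p (slot v)"

definition "eps v = e (slot v)"

lemma offset_0 [simp]: "offset 0 = 0" by (simp add: offset_def)

lemma offset_Suc [simp]: "offset (Suc l) = offset l + p l" by (simp add: offset_def)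

lemma offset_mono: "l \<le> k \<Longrightarrow> offset l \<le> offset k"
  by (rule lift_Suc_mono_le[of offset]) auto

lemma le_offset: "l \<le> offset l"
proof (induction l)
  case (Suc l)
  thus ?case using p_pos[of l] by simp
qed simp

lemma slot_eq: "offset l \<le> v \<Longrightarrow> v < offset (Suc l) \<Longrightarrow> slot v = l"
  unfolding slot_def
proof (rule Least_equality)
  fix k assume *: "offset l \<le> v" "v < offset (Suc k)"
  show "l \<le> k"
  proof (rule ccontr)
    assume "\<not> l \<le> k"
    hence "offset (Suc k) \<le> offset l" by (intro offset_mono) auto
    thus False using * by simp
  qed
qed

lemma slot_add [simp]: "k < p l \<Longrightarrow> slot (offset l + k) = l"
  by (rule slot_eq) auto

lemma slot_offset [simp]: "slot (offset l) = l"
  using slot_add[of 0 l] p_pos[of l] by simp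

lemma slot_cases:
  obtains k where "v = offset (slot v) + k" "k < p (slot v)"
proof -
  \<comment> \<open>Exponents are positive, so an offset is at least its index; this witness makes
    the \<open>LEAST\<close> in \<open>slot\<close> meaningful.\<close>
  have "v < offset (Suc v)" using le_offset[of "Suc v"] by linarith
  hence up: "v < offset (Suc (slot v))" unfolding slot_def by (rule LeastI)
  have lo: "offset (slot v) \<le> v"
  proof (cases "slot v")
    case (Suc l)
    hence "\<not> v < offset (Suc l)" unfolding slot_def by (metis lessI not_less_Least)
    thus ?thesis using Suc by simp
  qed simp
  show ?thesis using that[of "v - offset (slot v)"] up lo by auto
qed

lemma slot_mono: "v \<le> w \<Longrightarrow> slot v \<le> slot w"
proof (rule ccontr)
  assume "v \<le> w" "\<not> slot v \<le> slot w"
  moreover from this have "offset (Suc (slot w)) \<le> offset (slot v)" by (intro offset_mono) auto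
  moreover obtain k l where "v = offset (slot v) + k" "w = offset (slot w) + l" "l < p (slot w)"
    using slot_cases by metis
  ultimately show False by simp
qed

lemma slot_less_imp_less: "slot v < slot w \<Longrightarrow> v < w"
  using slot_mono[of w v] by linarith

lemma slot_less_iff: "slot v < s \<longleftrightarrow> v < offset s"
proof
  assume "slot v < s"
  hence "offset (Suc (slot v)) \<le> offset s" by (intro offset_mono) auto
  moreover obtain k where "v = offset (slot v) + k" "k < p (slot v)" by (rule slot_cases)
  ultimately show "v < offset s" by simp
next
  assume "v < offset s"
  thus "slot v < s" using offset_mono[of s "slot v"] slot_cases[of v] by (metis le_add1 le_trans not_le)
qed

lemma rot_add: "k < p l \<Longrightarrow> rot (offset l + k) = offset l + Suc k mod p l"
  by (simp add: rot_def)

lemma slot_rot [simp]: "slot (rot v) = slot v"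
  using p_pos[of "slot v"] unfolding rot_def by (intro slot_add) auto

lemma eps_rot [simp]: "eps (rot v) = eps v" by (simp add: eps_def)

lemma bij_rot: "bij_betw rot {..< offset s} {..< offset s}"
proof -
  have "inj_on rot {..< offset s}"
  proof (rule inj_onI)
    fix v w assume eq: "rot v = rot w"
    hence fac: "slot v = slot w" by (metis slot_rot)
    obtain k l where kl: "v = offset (slot v) + k" "k < p (slot v)"
      "w = offset (slot w) + l" "l < p (slot w)" using slot_cases by metis
    have "Suc k mod p (slot v) = Suc l mod p (slot v)"
      using eq kl rot_add[of k "slot v"] rot_add[of l "slot w"] fac by (metis add_left_cancel)
    hence "k = l" using kl fac by (metis Suc_mod_inj)
    thus "v = w" using kl fac by metis
  qed
  moreover have "rot ` {..< offset s} \<subseteq> {..< offset s}"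
    by (auto simp: slot_less_iff[symmetric])
  ultimately show ?thesis by (simp add: bij_betw_def endo_inj_surj)
qed

text \<open>For an involution \<open>f\<close> the second condition says that \<open>f\<close>
  conjugates \<open>rot\<close> to its inverse: a matched factor is run through backwards.
  Equivalently, \<open>f\<close> composed with the inverse of \<open>rot\<close> is an involution,
  the case of maximally many free indices.\<close>

definition "word_match s f \<longleftrightarrow> (\<forall>v< offset s. eps (f v) \<noteq> eps v \<and> rot (f (rot v)) = f v)"

definition "slot_match s f \<longleftrightarrow> (\<forall>a<s. p (f a) = p a \<and> e (f a) \<noteq> e a)"

text \<open>Nested arches between factor \<open>a\<close> and factor \<open>f a\<close>: letter
  \<open>k\<close> meets letter \<open>p a - 1 - k\<close>. The length of the target is taken to be
  \<open>p a\<close>, as \<open>slot_match\<close> ensures.\<close>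

definition "rainbow f v = offset (f (slot v)) + (p (slot v) - 1 - (v - offset (slot v)))"

lemma rainbow_add: "k < p a \<Longrightarrow> rainbow f (offset a + k) = offset (f a) + (p a - 1 - k)"
  by (simp add: rainbow_def)

lemma slot_rainbow:
  assumes "slot_match s f" "v < offset s"
  shows "slot (rainbow f v) = f (slot v)"
proof -
  have "p (f (slot v)) = p (slot v)" using assms by (simp add: slot_match_def slot_less_iff)
  thus ?thesis unfolding rainbow_def using p_pos[of "slot v"] by (intro slot_add) simp
qed

text \<open>Reflection inside factors turns \<open>rot\<close> into its inverse, hence
  \<open>word_match\<close>. Two crossing arches would either start in one factor, where arches are
  nested, or project to a crossing of \<open>f\<close>.\<close>

lemma rainbow:
  assumes f: "nc_invol s f" and c: "slot_match s f"
  shows "nc_invol (offset s) (rainbow f)" "word_match s (rainbow f)"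
proof -
  note fac = slot_rainbow[OF c]
  have 1: "rainbow f v < offset s \<and> rainbow f v \<noteq> v \<and> rainbow f (rainbow f v) = v \<and>
     eps (rainbow f v) \<noteq> eps v \<and> rot (rainbow f (rot v)) = rainbow f v"
    if v: "v < offset s" for v
  proof -
    define a where "a = slot v"
    obtain k where k: "v = offset a + k" "k < p a" using slot_cases a_def by metis
    have a: "a < s" using v by (simp add: a_def slot_less_iff)
    have fa: "p (f a) = p a" "e (f a) \<noteq> e a" "f a < s" "f (f a) = a" "f a \<noteq> a"
      using f c a by (auto simp: slot_match_def nc_invol_def)
    have 2: "rainbow f v = offset (f a) + (p a - 1 - k)" using k by (simp add: rainbow_add)
    have 3: "rainbow f v < offset s" using fac[OF v] fa by (simp add: slot_less_iff[symmetric] a_def)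
    have 4: "rainbow f v \<noteq> v" using fac[OF v] fa by (metis a_def)
    have 5: "rainbow f (rainbow f v) = v"
      using rainbow_add[of "p a - 1 - k" "f a" f] fa k unfolding 2 by simp
    have 6: "eps (rainbow f v) \<noteq> eps v" using fac[OF v] fa by (simp add: eps_def a_def)
    have 7: "rot (rainbow f (rot v)) = rainbow f v"
    \<comment> \<open>At the last letter \<open>rot\<close> wraps around to the first, and then it
      wraps around at the reflected letter as well.\<close>
    proof (cases "Suc k = p a")
      case True
      hence "rot v = offset a + 0" using k rot_add[of k a] by simp
      hence "rainbow f (rot v) = offset (f a) + k"
        using rainbow_add[of 0 a f] k True p_pos[of a] by simp
      thus ?thesis using 2 rot_add[of k "f a"] True k fa by simp
    next
      case False
      hence "rot v = offset a + Suc k" using k rot_add[of k a] by simp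
      hence "rainbow f (rot v) = offset (f a) + (p a - 1 - Suc k)"
        using rainbow_add[of "Suc k" a f] k False by simp
      moreover have "Suc (p a - 1 - Suc k) = p a - 1 - k" using k False by simp
      ultimately show ?thesis using 2 rot_add[of "p a - 1 - Suc k" "f a"] False k fa by simp
    qed
    show ?thesis using 3 4 5 6 7 by blast
  qed
  have 2: "\<not> w < offset s" if *: "v < w \<and> w < rainbow f v \<and> rainbow f v < rainbow f w" for v w
  proof
    assume w: "w < offset s"
    define a b where "a = slot v" and "b = slot w"
    have v: "v < offset s" using w * by simp
    have ab: "a < s" "b < s" using v w by (auto simp: a_def b_def slot_less_iff)
    have fab: "f (f a) = a" "f (f b) = b" "f a \<noteq> a" "f b \<noteq> b" using f ab by (auto simp: nc_invol_def)
    \<comment> \<open>Projection to the factors keeps only weak inequalities, so each equality has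
      to be excluded: the first by nesting inside a factor, the others by \<open>f\<close> being an
      involution without fixed points.\<close>
    have "a \<le> b" "b \<le> f a" "f a \<le> f b"
      using * slot_mono[of v w] slot_mono[of w "rainbow f v"] slot_mono[of "rainbow f v" "rainbow f w"]
        fac[OF v] fac[OF w] by (auto simp: a_def b_def)
    moreover have "a \<noteq> b"
    proof
      assume ab: "a = b"
      obtain k l where "v = offset a + k" "k < p a" "w = offset b + l" "l < p b"
        using slot_cases a_def b_def by metis
      hence "k < l" "rainbow f v = offset (f b) + (p b - 1 - k)"
        "rainbow f w = offset (f b) + (p b - 1 - l)"
        using ab * by (simp_all add: rainbow_add)
      thus False using * by arith
    qed
    moreover have "b \<noteq> f a" using calculation fab by auto
    moreover have "f a \<noteq> f b" using calculation fab by metis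
    ultimately show False using f ab unfolding nc_invol_def by (meson order_less_le)
  qed
  show "nc_invol (offset s) (rainbow f)" unfolding nc_invol_def using 1 2 by blast
  show "word_match s (rainbow f)" unfolding word_match_def using 1 by blast
qed

text \<open>By noncrossingness a compatible pairing matches two factors in reverse order; being
  strictly decreasing in both directions forces the factors to have the same length.\<close>

lemma word_match_rainbow:
  assumes q: "nc_invol (offset s) q" and c: "word_match s q"
  defines "f \<equiv> \<lambda>a. slot (q (offset a))"
  shows "nc_invol s f" "slot_match s f" "\<And>v. v < offset s \<Longrightarrow> q v = rainbow f v"
proof -
  have less: "offset a + k < offset s" if "a < s" "k < p a" for a k
    using that by (simp add: slot_less_iff[symmetric])
  \<comment> \<open>As \<open>rot\<close> stays inside a factor,
    \<open>rot (q (rot v)) = q v\<close> keeps the image in one factor while \<open>v\<close> moves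
    along its own.\<close>
  have fac_add: "slot (q (offset a + k)) = f a" if "a < s" "k < p a" for a k
    using that(2)
  proof (induction k)
    case (Suc k)
    have "rot (offset a + k) = offset a + Suc k" using rot_add[of k a] Suc.prems by simp
    moreover have "rot (q (rot (offset a + k))) = q (offset a + k)"
      using c less[OF that(1), of k] Suc.prems unfolding word_match_def by simp
    ultimately have "slot (q (offset a + Suc k)) = slot (q (offset a + k))"
      by (metis slot_rot)
    thus ?case using Suc by simp
  qed (simp add: f_def)
  have fac: "slot (q v) = f (slot v)" if "v < offset s" for v
  proof -
    obtain k where k: "v = offset (slot v) + k" "k < p (slot v)" by (rule slot_cases)
    have "slot (q (offset (slot v) + k)) = f (slot v)"
      using fac_add[OF _ k(2)] that by (simp add: slot_less_iff)
    thus ?thesis using k(1) by simp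
  qed
  have qs: "q v < offset s" "q v \<noteq> v" "q (q v) = v" "eps (q v) \<noteq> eps v" if "v < offset s" for v
    using q c that by (auto simp: nc_invol_def word_match_def)
  have off: "offset a < offset s" if "a < s" for a using that by (simp add: slot_less_iff[symmetric])
  have f: "f a < s" "f (f a) = a" "e (f a) \<noteq> e a" "f a \<noteq> a" if "a < s" for a
  proof -
    note o = off[OF that]
    show "f a < s" using qs(1)[OF o] by (simp add: f_def slot_less_iff)
    show "f (f a) = a" using fac[OF qs(1)[OF o]] qs(3)[OF o] by (simp add: f_def)
    show "e (f a) \<noteq> e a" using qs(4)[OF o] by (simp add: eps_def f_def)
    thus "f a \<noteq> a" by auto
  qed
  have nc: "\<not> (v < w \<and> w < q v \<and> q v < q w)" if "w < offset s" for v w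
    using q that unfolding nc_invol_def by blast
  have "\<not> b < s" if "a < b \<and> b < f a \<and> f a < f b" for a b
  proof
    assume "b < s"
    hence o: "offset a < offset s" "offset b < offset s" using off that by auto
    have "offset a < offset b" "offset b < q (offset a)" "q (offset a) < q (offset b)"
      using that fac[OF o(1)] fac[OF o(2)] by (auto intro: slot_less_imp_less)
    thus False using nc[OF o(2)] by blast
  qed
  thus ncf: "nc_invol s f" using f unfolding nc_invol_def by blast
  \<comment> \<open>The images of a factor lie in one other factor, hence all to its right or all to
    its left. If \<open>q\<close> increased on two letters, their pairs would cross; on the left,
    the crossing chain starts with the images.\<close>
  have dec: "q w < q v" if vw: "v < w" "w < offset s" "slot v = slot w" for v w
  proof (rule ccontr)
    assume "\<not> q w < q v"
    moreover have "q v \<noteq> q w" using qs(3)[of v] qs(3)[of w] vw by force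
    ultimately have lt: "q v < q w" by simp
    have v: "v < offset s" using vw by simp
    have "slot (q v) = slot (q w)" "slot (q v) \<noteq> slot v"
      using fac[OF v] fac[OF vw(2)] vw f(4)[of "slot v"] v by (auto simp: slot_less_iff)
    then consider "slot w < slot (q v)" | "slot (q w) < slot v"
      using vw(3) by linarith
    then consider "w < q v" | "q w < v" using slot_less_imp_less by blast
    thus False
    proof cases
      case 1
      thus ?thesis using nc[OF vw(2)] vw lt by blast
    next
      case 2
      thus ?thesis using nc[OF qs(1)[OF vw(2)], of "q v"] qs(3)[OF v] qs(3)[OF vw(2)] vw lt by simp
    qed
  qed
  define r where "r a k = q (offset a + k) - offset (f a)" for a k
  have r: "q (offset a + k) = offset (f a) + r a k" "r a k < p (f a)" if ak: "a < s" "k < p a" for a k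
  proof -
    obtain l where "q (offset a + k) = offset (f a) + l" "l < p (f a)"
      using slot_cases[of "q (offset a + k)"] fac_add[OF ak] by metis
    thus "q (offset a + k) = offset (f a) + r a k" "r a k < p (f a)" by (simp_all add: r_def)
  qed
  \<comment> \<open>Strict decrease makes \<open>r a k + k\<close> nonincreasing in
    \<open>k\<close>. Comparing \<open>k = 0\<close> with \<open>k = p a - 1\<close> bounds
    \<open>p a\<close> by \<open>p (f a)\<close>, and symmetry gives equality; after that the same
    quantity is squeezed to the constant \<open>p a - 1\<close>.\<close>
  have step: "r a k + k \<le> r a l + l" if "a < s" "l \<le> k" "k < p a" for a k l
    using that(2)
  proof (induction rule: dec_induct)
    case (step m)
    have m: "Suc m < p a" using step that(3) by simp
    have "q (offset a + Suc m) < q (offset a + m)"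
      using slot_add[of m a] slot_add[OF m] less[OF that(1) m] m by (intro dec) simp_all
    hence "r a (Suc m) < r a m" using r(1)[OF that(1), of m] r(1)[OF that(1) m] m by simp
    thus ?case using step by simp
  qed simp
  have ple: "p a \<le> p (f a)" if "a < s" for a
    using step[OF that, of 0 "p a - 1"] r(2)[OF that, of 0] p_pos[of a] by simp
  have peq: "p (f a) = p a" if "a < s" for a
    using ple[OF that] ple[OF f(1)[OF that]] f(2)[OF that] by simp
  show "slot_match s f" unfolding slot_match_def using peq f by blast
  show "q v = rainbow f v" if "v < offset s" for v
  proof -
    define a where "a = slot v"
    have a: "a < s" using that by (simp add: a_def slot_less_iff)
    obtain k where k: "v = offset a + k" "k < p a" using slot_cases a_def by metis
    have "r a k + k \<le> r a 0" "r a 0 < p a" "r a (p a - 1) + (p a - 1) \<le> r a k + k"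
      using step[OF a, of 0 k] r(2)[OF a, of 0] peq[OF a] k step[OF a, of k "p a - 1"] by auto
    hence "r a k = p a - 1 - k" by simp
    thus ?thesis using r(1)[OF a k(2)] k by (simp add: rainbow_add)
  qed
qed

text \<open>Lifting by \<open>rainbow\<close> is undone by reading off the factor matched with the
  first letter of each factor, so compatible pairings of letters are counted by pairings of
  factors.\<close>

lemma card_compat_pairings:
  "card {P \<in> NC2 (offset s). word_match s (part_next P)} = card {Q \<in> NC2 s. slot_match s (part_next Q)}"
  (is "card ?A = card ?B")
proof -
  let ?\<Phi> = "\<lambda>Q. pairs_of (offset s) (rainbow (part_next Q))"
  have wd: "nc_invol (offset s) (rainbow (part_next Q))" "word_match s (rainbow (part_next Q))"
    if "Q \<in> ?B" for Q using rainbow[OF NC2_invol(1), of Q s] that by auto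
  have less: "rot v < offset s" if "v < offset s" for v
    using that by (simp add: slot_less_iff[symmetric])
  have "inj_on ?\<Phi> ?B"
  proof (rule inj_onI)
    fix Q R assume Q: "Q \<in> ?B" and R: "R \<in> ?B" and eq: "?\<Phi> Q = ?\<Phi> R"
    have "part_next Q a = part_next R a" if "a < s" for a
    proof -
      have o: "offset a < offset s" using that by (simp add: slot_less_iff[symmetric])
      have "rainbow (part_next Q) (offset a) = rainbow (part_next R) (offset a)"
        using part_next_pairs_of[OF wd(1)[OF Q] o] part_next_pairs_of[OF wd(1)[OF R] o] eq by simp
      moreover have "slot (rainbow (part_next Q) (offset a)) = part_next Q a"
        "slot (rainbow (part_next R) (offset a)) = part_next R a"
        using slot_rainbow[OF _ o] Q R by simp_all
      ultimately show ?thesis by simp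
    qed
    hence "pairs_of s (part_next Q) = pairs_of s (part_next R)" by (rule pairs_of_cong)
    thus "Q = R" using NC2_invol(2)[of Q s] NC2_invol(2)[of R s] Q R by simp
  qed
  moreover have "?\<Phi> ` ?B = ?A"
  proof (intro equalityI subsetI)
    fix P assume "P \<in> ?\<Phi> ` ?B"
    then obtain Q where Q: "Q \<in> ?B" and P: "P = ?\<Phi> Q" by blast
    have "word_match s (part_next P)"
      using wd(2)[OF Q] part_next_pairs_of[OF wd(1)[OF Q]] less unfolding P word_match_def by simp
    thus "P \<in> ?A" using pairs_of_in_NC2[OF wd(1)[OF Q]] P by simp
  next
    fix P assume P: "P \<in> ?A"
    define f where "f = (\<lambda>a. slot (part_next P (offset a)))"
    have f: "nc_invol s f" "slot_match s f" "\<And>v. v < offset s \<Longrightarrow> part_next P v = rainbow f v"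
      using word_match_rainbow[OF NC2_invol(1), of P s] P unfolding f_def by auto
    have g: "part_next (pairs_of s f) a = f a" if "a < s" for a
      by (rule part_next_pairs_of[OF f(1) that])
    have B: "pairs_of s f \<in> ?B"
      using pairs_of_in_NC2[OF f(1)] f(2) g by (simp add: slot_match_def)
    have "P = ?\<Phi> (pairs_of s f)"
    proof -
      have "?\<Phi> (pairs_of s f) = pairs_of (offset s) (part_next P)"
        using f(3) g by (intro pairs_of_cong) (simp add: rainbow_def slot_less_iff)
      thus ?thesis using NC2_invol(2)[of P "offset s"] P by simp
    qed
    thus "P \<in> ?\<Phi> ` ?B" by (rule image_eqI[OF _ B])
  qed
  ultimately show ?thesis using card_image[of ?\<Phi> ?B] by simp
qed

end

section \<open>Moments of traces of powers\<close>

lemma sum_index_lists_append: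
  "(\<Sum>zs\<in>index_lists n (q + r). g zs) =
   (\<Sum>xs\<in>index_lists n q. \<Sum>ys\<in>index_lists n r. g (xs @ ys))"
proof -
  have "(\<Sum>zs\<in>index_lists n (q + r). g zs) =
      (\<Sum>z\<in>index_lists n q \<times> index_lists n r. g (fst z @ snd z))"
  proof (rule sum.reindex_bij_witness[where i = "\<lambda>z. fst z @ snd z" and j = "\<lambda>zs. (take q zs, drop q zs)"])
    fix zs assume "zs \<in> index_lists n (q + r)"
    thus "(take q zs, drop q zs) \<in> index_lists n q \<times> index_lists n r"
      using set_take_subset[of q zs] set_drop_subset[of q zs] by (auto simp: index_lists_def)
  qed (auto simp: index_lists_def)
  thus ?thesis by (simp add: sum.cartesian_product case_prod_beta)
qed

lemma index_lists_0 [simp]: "index_lists n 0 = {[]}"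
  by (auto simp: index_lists_def)

lemma sum_index_lists_1: "(\<Sum>zs\<in>index_lists n (Suc 0). g zs) = (\<Sum>k\<in>{1..n}. g [k])"
proof (rule sum.reindex_bij_witness[where i = "\<lambda>k. [k]" and j = hd])
  fix zs assume "zs \<in> index_lists n (Suc 0)"
  then obtain k where "zs = [k]" "k \<in> {1..n}"
    by (auto simp: index_lists_def length_Suc_conv)
  thus "[hd zs] = zs" "hd zs \<in> {1..n}" "g [hd zs] = g zs" by auto
qed (auto simp: index_lists_def)

lemma sum_index_lists_snoc:
  "(\<Sum>zs\<in>index_lists n (Suc q). g zs) = (\<Sum>k\<in>{1..n}. \<Sum>ys\<in>index_lists n q. g (ys @ [k]))"
  using sum_index_lists_append[of g n q 1] sum.swap by (simp add: sum_index_lists_1 sum.swap[of _ "{1..n}"])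

lemma sum_index_lists_Cons:
  "(\<Sum>zs\<in>index_lists n (Suc q). g zs) = (\<Sum>k\<in>{1..n}. \<Sum>ys\<in>index_lists n q. g (k # ys))"
  using sum_index_lists_append[of g n 1 q] by (simp add: sum_index_lists_1)

section \<open>Products of matrix entries along paths\<close>

definition path :: "'a mat_fun \<Rightarrow> nat list \<Rightarrow> 'a list" where
  "path M zs = map2 M zs (tl zs)"

lemma path_singleton [simp]: "path M [x] = []"
  and path_Cons [simp]: "path M (x # y # zs) = M x y # path M (y # zs)"
  by (auto simp: path_def)

lemma path_snoc: "path M (zs @ [y, z]) = path M (zs @ [y]) @ [M y z]"
proof (induction zs)
  case (Cons x zs)
  thus ?case by (cases zs) auto
qed simp

lemma length_path [simp]: "length (path M zs) = length zs - 1"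
  by (simp add: path_def)

lemma nth_path: "Suc k < length zs \<Longrightarrow> path M zs ! k = M (zs ! k) (zs ! Suc k)"
  by (simp add: path_def nth_tl)

lemma set_path:
  assumes "\<And>i j. i \<in> I \<Longrightarrow> j \<in> I \<Longrightarrow> M i j \<in> C" "set zs \<subseteq> I"
  shows "set (path M zs) \<subseteq> C"
  using assms(2)
proof (induction zs)
  case (Cons x zs)
  thus ?case using assms(1) by (cases zs) auto
qed (simp add: path_def)

context complex_star_algebra
begin

lemma list_mult_closed: "set xs \<subseteq> carrier A \<Longrightarrow> list_mult A xs \<in> carrier A"
  by (induction xs) (auto simp: list_mult_def)

lemma list_mult_Cons: "list_mult A (x # xs) = x \<otimes> list_mult A xs"
  by (simp add: list_mult_def)

lemma list_mult_append:
  "\<lbrakk>set xs \<subseteq> carrier A; set ys \<subseteq> carrier A\<rbrakk> \<Longrightarrow>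
   list_mult A (xs @ ys) = list_mult A xs \<otimes> list_mult A ys"
proof (induction xs)
  case Nil
  thus ?case using list_mult_closed[of ys] by (simp add: list_mult_def)
next
  case (Cons x xs)
  thus ?case using list_mult_closed[of xs] list_mult_closed[of ys]
    by (simp add: list_mult_Cons m_assoc)
qed

lemma list_mult_single: "x \<in> carrier A \<Longrightarrow> list_mult A [x] = x"
  by (simp add: list_mult_def)

lemma star_finsum:
  assumes "finite K" "f \<in> K \<rightarrow> carrier A"
  shows "(\<Oplus>k\<in>K. f k)\<^sup>\<star> = (\<Oplus>k\<in>K. (f k)\<^sup>\<star>)"
  using assms
proof (induction K)
  case (insert k K)
  hence "f \<in> K \<rightarrow> carrier A" "f k \<in> carrier A" "(\<lambda>k. (f k)\<^sup>\<star>) \<in> K \<rightarrow> carrier A" by auto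
  thus ?case using insert by (simp add: star_add)
qed simp

lemma mat_pow_closed:
  assumes "\<And>i j. i \<in> {1..n} \<Longrightarrow> j \<in> {1..n} \<Longrightarrow> M i j \<in> carrier A"
    and "i \<in> {1..n}" "j \<in> {1..n}"
  shows "mat_pow A n M q i j \<in> carrier A"
  using assms(2,3)
proof (induction q arbitrary: i j)
  case 0
  thus ?case by (simp add: mat_one_def)
next
  case (Suc q)
  show ?case unfolding mat_pow.simps
    by (rule mat_mult_closed[OF ring_axioms Suc.IH assms(1) Suc.prems])
qed

text \<open>The expansions below start at exponent 1, since the entries of power 0 are Kronecker
  deltas and not sums over paths.\<close>

lemma mat_pow_1:
  assumes "\<And>i j. i \<in> {1..n} \<Longrightarrow> j \<in> {1..n} \<Longrightarrow> M i j \<in> carrier A"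
    and "i \<in> {1..n}" "j \<in> {1..n}"
  shows "mat_pow A n M (Suc 0) i j = M i j"
proof -
  have "mat_pow A n M (Suc 0) i j = (\<Oplus>k\<in>{1..n}. (if i = k then \<one> else \<zero>) \<otimes> M k j)"
    by (simp add: mat_mult_def mat_one_def)
  also have "\<dots> = (\<Oplus>k\<in>{1..n}. if i = k then M k j else \<zero>)"
    using assms(1)[OF _ assms(3)] by (intro add.finprod_cong') (auto simp del: atLeastAtMost_iff)
  also have "\<dots> = M i j"
    using assms by (intro add.finprod_singleton) auto
  finally show ?thesis .
qed

end

locale star_functional = complex_star_algebra A
    for A :: "('a, 'm) star_algebra_scheme" (structure) +
  fixes \<phi> :: "'a \<Rightarrow> complex"
  assumes functional: "unital_linear_functional A \<phi>"
begin

lemma phi_add: "x \<in> carrier A \<Longrightarrow> y \<in> carrier A \<Longrightarrow> \<phi> (x \<oplus> y) = \<phi> x + \<phi> y"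
  using functional by (simp add: unital_linear_functional_def)

lemma phi_zero: "\<phi> \<zero> = 0"
  using phi_add[of \<zero> \<zero>] by simp

text \<open>The two outer factors allow a sum to be pulled out of the middle of a word, after which
  all sums are of complex numbers.\<close>

lemma phi_finsum:
  assumes "finite K" "f \<in> K \<rightarrow> carrier A" "a \<in> carrier A" "b \<in> carrier A"
  shows "\<phi> (a \<otimes> (\<Oplus>k\<in>K. f k) \<otimes> b) = (\<Sum>k\<in>K. \<phi> (a \<otimes> f k \<otimes> b))"
  using assms
proof (induction K)
  case empty
  thus ?case by (simp add: phi_zero)
next
  case (insert k K)
  hence f: "f \<in> K \<rightarrow> carrier A" "f k \<in> carrier A" by auto
  have "a \<otimes> (\<Oplus>k\<in>insert k K. f k) \<otimes> b = a \<otimes> f k \<otimes> b \<oplus> a \<otimes> (\<Oplus>k\<in>K. f k) \<otimes> b"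
    using insert f by (simp add: finsum_closed r_distr l_distr)
  thus ?case using insert f by (simp add: phi_add finsum_closed)
qed

context
  fixes n :: nat and M :: "'a mat_fun"
  assumes M: "\<And>i j. i \<in> {1..n} \<Longrightarrow> j \<in> {1..n} \<Longrightarrow> M i j \<in> carrier A"
begin

lemma path_closed: "set zs \<subseteq> {1..n} \<Longrightarrow> list_mult A (path M zs) \<in> carrier A"
  by (intro list_mult_closed set_path[of "{1..n}"] M)

lemma star_M: "i \<in> {1..n} \<Longrightarrow> j \<in> {1..n} \<Longrightarrow> mat_star A M i j \<in> carrier A"
  using M unfolding mat_star_def by blast

lemma path_star_closed: "set zs \<subseteq> {1..n} \<Longrightarrow> list_mult A (path (mat_star A M) zs) \<in> carrier A"
  by (intro list_mult_closed set_path[of "{1..n}"] star_M)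

text \<open>The induction moves the last entry of the matrix product into the right-hand factor, so
  \<open>b\<close> varies while \<open>a\<close> is fixed.\<close>

lemma phi_mat_pow:
  assumes "i \<in> {1..n}" "j \<in> {1..n}" "a \<in> carrier A" "b \<in> carrier A"
  shows "\<phi> (a \<otimes> mat_pow A n M (Suc q) i j \<otimes> b) =
    (\<Sum>ys\<in>index_lists n q. \<phi> (a \<otimes> list_mult A (path M (i # ys @ [j])) \<otimes> b))"
  using assms(2,4)
proof (induction q arbitrary: j b)
  case 0
  have "mat_pow A n M (Suc 0) i j = M i j" by (rule mat_pow_1[OF M assms(1) 0(1)])
  thus ?case using M[OF assms(1) 0(1)] by (simp add: list_mult_single del: mat_pow.simps)
next
  case (Suc q)
  let ?pow = "mat_pow A n M (Suc q)"
  have pow: "?pow i k \<in> carrier A" if "k \<in> {1..n}" for k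
    by (rule mat_pow_closed[OF M assms(1) that])
  note Mj = M[OF _ Suc.prems(1)]
  have "\<phi> (a \<otimes> mat_pow A n M (Suc (Suc q)) i j \<otimes> b) =
      (\<Sum>k\<in>{1..n}. \<phi> (a \<otimes> (?pow i k \<otimes> M k j) \<otimes> b))"
    unfolding mat_pow.simps(2)[of _ _ _ "Suc q"] mat_mult_def
    by (rule phi_finsum) (use pow Mj assms Suc.prems in blast)+
  also have "\<dots> = (\<Sum>k\<in>{1..n}. \<phi> (a \<otimes> ?pow i k \<otimes> (M k j \<otimes> b)))"
  proof (rule sum.cong)
    fix k assume k: "k \<in> {1..n}"
    show "\<phi> (a \<otimes> (?pow i k \<otimes> M k j) \<otimes> b) = \<phi> (a \<otimes> ?pow i k \<otimes> (M k j \<otimes> b))"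
      using pow[OF k] Mj[OF k] assms(3) Suc.prems(2) by (simp only: m_assoc m_closed)
  qed simp
  also have "\<dots> = (\<Sum>k\<in>{1..n}. \<Sum>ys\<in>index_lists n q.
      \<phi> (a \<otimes> list_mult A (path M (i # ys @ [k])) \<otimes> (M k j \<otimes> b)))"
    by (rule sum.cong[OF refl], rule Suc.IH) (use Mj Suc.prems in \<open>blast intro: m_closed\<close>)+
  also have "\<dots> = (\<Sum>k\<in>{1..n}. \<Sum>ys\<in>index_lists n q.
      \<phi> (a \<otimes> list_mult A (path M (i # (ys @ [k]) @ [j])) \<otimes> b))"
  proof (intro sum.cong refl)
    fix k ys assume k: "k \<in> {1..n}" and ys: "ys \<in> index_lists n q"
    have zs: "set (i # ys @ [k]) \<subseteq> {1..n}" using k ys assms(1) by (auto simp: index_lists_def)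
    have "set (path M (i # ys @ [k])) \<subseteq> carrier A" by (rule set_path[OF M zs])
    hence "list_mult A (path M (i # (ys @ [k]) @ [j])) = list_mult A (path M (i # ys @ [k])) \<otimes> M k j"
      using path_snoc[of M "i # ys" k j] Mj[OF k] by (simp add: list_mult_append list_mult_single)
    thus "\<phi> (a \<otimes> list_mult A (path M (i # ys @ [k])) \<otimes> (M k j \<otimes> b)) =
        \<phi> (a \<otimes> list_mult A (path M (i # (ys @ [k]) @ [j])) \<otimes> b)"
      using path_closed[OF zs] Mj[OF k] assms(3) Suc.prems(2) by (simp only: m_assoc m_closed)
  qed
  finally show ?case by (simp only: sum_index_lists_snoc)
qed

text \<open>The star reverses the product, so the entry split off stands on the left and is absorbed
  by \<open>a\<close>; for the same reason the path leads from \<open>j\<close> to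
  \<open>i\<close>.\<close>

lemma phi_mat_pow_star:
  assumes "i \<in> {1..n}" "j \<in> {1..n}" "a \<in> carrier A" "b \<in> carrier A"
  shows "\<phi> (a \<otimes> (mat_pow A n M (Suc q) i j)\<^sup>\<star> \<otimes> b) =
    (\<Sum>ys\<in>index_lists n q. \<phi> (a \<otimes> list_mult A (path (mat_star A M) (j # ys @ [i])) \<otimes> b))"
  using assms(2,3)
proof (induction q arbitrary: j a)
  case 0
  have "mat_pow A n M (Suc 0) i j = M i j" by (rule mat_pow_1[OF M assms(1) 0(1)])
  thus ?case using M[OF assms(1) 0(1)]
    by (simp add: list_mult_single mat_star_def del: mat_pow.simps)
next
  case (Suc q)
  let ?pow = "mat_pow A n M (Suc q)"
  have pow: "?pow i k \<in> carrier A" if "k \<in> {1..n}" for k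
    by (rule mat_pow_closed[OF M assms(1) that])
  note Mj = M[OF _ Suc.prems(1)]
  have "(mat_pow A n M (Suc (Suc q)) i j)\<^sup>\<star> = (\<Oplus>k\<in>{1..n}. (?pow i k \<otimes> M k j)\<^sup>\<star>)"
    unfolding mat_pow.simps(2)[of _ _ _ "Suc q"] mat_mult_def
    by (rule star_finsum) (use pow Mj in blast)+
  also have "\<dots> = (\<Oplus>k\<in>{1..n}. mat_star A M j k \<otimes> (?pow i k)\<^sup>\<star>)"
    using pow Mj by (intro add.finprod_cong')
      (auto simp: star_mult mat_star_def simp del: atLeastAtMost_iff mat_pow.simps)
  finally have "\<phi> (a \<otimes> (mat_pow A n M (Suc (Suc q)) i j)\<^sup>\<star> \<otimes> b) =
      \<phi> (a \<otimes> (\<Oplus>k\<in>{1..n}. mat_star A M j k \<otimes> (?pow i k)\<^sup>\<star>) \<otimes> b)" by (simp only:)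
  also have "\<dots> = (\<Sum>k\<in>{1..n}. \<phi> (a \<otimes> (mat_star A M j k \<otimes> (?pow i k)\<^sup>\<star>) \<otimes> b))"
    by (rule phi_finsum) (use pow star_M assms Suc.prems in blast)+
  also have "\<dots> = (\<Sum>k\<in>{1..n}. \<phi> ((a \<otimes> mat_star A M j k) \<otimes> (?pow i k)\<^sup>\<star> \<otimes> b))"
  proof (rule sum.cong)
    fix k assume k: "k \<in> {1..n}"
    show "\<phi> (a \<otimes> (mat_star A M j k \<otimes> (?pow i k)\<^sup>\<star>) \<otimes> b) = \<phi> ((a \<otimes> mat_star A M j k) \<otimes> (?pow i k)\<^sup>\<star> \<otimes> b)"
      using pow[OF k] star_M[OF Suc.prems(1) k] assms(4) Suc.prems(2)
      by (simp only: m_assoc m_closed star_closed)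
  qed simp
  also have "\<dots> = (\<Sum>k\<in>{1..n}. \<Sum>ys\<in>index_lists n q.
      \<phi> ((a \<otimes> mat_star A M j k) \<otimes> list_mult A (path (mat_star A M) (k # ys @ [i])) \<otimes> b))"
    by (rule sum.cong[OF refl], rule Suc.IH) (use star_M Suc.prems in \<open>blast intro: m_closed\<close>)+
  also have "\<dots> = (\<Sum>k\<in>{1..n}. \<Sum>ys\<in>index_lists n q.
      \<phi> (a \<otimes> list_mult A (path (mat_star A M) (j # (k # ys) @ [i])) \<otimes> b))"
  proof (intro sum.cong refl)
    fix k ys assume k: "k \<in> {1..n}" and ys: "ys \<in> index_lists n q"
    have zs: "set (k # ys @ [i]) \<subseteq> {1..n}" using k ys assms(1) by (auto simp: index_lists_def)
    show "\<phi> ((a \<otimes> mat_star A M j k) \<otimes> list_mult A (path (mat_star A M) (k # ys @ [i])) \<otimes> b) =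
        \<phi> (a \<otimes> list_mult A (path (mat_star A M) (j # (k # ys) @ [i])) \<otimes> b)"
      using path_star_closed[OF zs] star_M[OF Suc.prems(1) k] assms(4) Suc.prems(2)
      by (simp add: list_mult_Cons m_assoc)
  qed
  finally show ?case by (simp only: sum_index_lists_Cons)
qed

text \<open>On the diagonal the path is closed, so starred and unstarred powers share one formula:
  the start index joins the summed list and reappears at the end.\<close>

lemma phi_trace_power:
  assumes "a \<in> carrier A" "b \<in> carrier A"
  shows "\<phi> (a \<otimes> star_if A \<epsilon> (mat_trace A n (mat_pow A n M (Suc q))) \<otimes> b) =
    (\<Sum>xs\<in>index_lists n (Suc q).
      \<phi> (a \<otimes> list_mult A (path (if \<epsilon> then mat_star A M else M) (xs @ [hd xs])) \<otimes> b))"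
proof -
  let ?pow = "mat_pow A n M (Suc q)" and ?M = "if \<epsilon> then mat_star A M else M"
  have pow: "?pow k k \<in> carrier A" if "k \<in> {1..n}" for k
    by (rule mat_pow_closed[OF M that that])
  have "star_if A \<epsilon> (mat_trace A n ?pow) = (\<Oplus>k\<in>{1..n}. star_if A \<epsilon> (?pow k k))"
    unfolding mat_trace_def star_if_def
    using star_finsum[of "{1..n}" "\<lambda>k. ?pow k k"] pow by (cases \<epsilon>) (simp_all add: Pi_def del: mat_pow.simps atLeastAtMost_iff)
  hence "\<phi> (a \<otimes> star_if A \<epsilon> (mat_trace A n ?pow) \<otimes> b) =
      \<phi> (a \<otimes> (\<Oplus>k\<in>{1..n}. star_if A \<epsilon> (?pow k k)) \<otimes> b)" by (simp only:)
  also have "\<dots> = (\<Sum>k\<in>{1..n}. \<phi> (a \<otimes> star_if A \<epsilon> (?pow k k) \<otimes> b))"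
    by (rule phi_finsum) (use pow assms in \<open>auto simp: star_if_def simp del: mat_pow.simps atLeastAtMost_iff\<close>)
  also have "\<dots> = (\<Sum>k\<in>{1..n}. \<Sum>ys\<in>index_lists n q. \<phi> (a \<otimes> list_mult A (path ?M (k # ys @ [k])) \<otimes> b))"
    using phi_mat_pow[OF _ _ assms] phi_mat_pow_star[OF _ _ assms]
    by (intro sum.cong) (simp_all add: star_if_def del: mat_pow.simps atLeastAtMost_iff)
  also have "\<dots> = (\<Sum>k\<in>{1..n}. \<Sum>ys\<in>index_lists n q.
      \<phi> (a \<otimes> list_mult A (path ?M ((k # ys) @ [hd (k # ys)])) \<otimes> b))" by simp
  finally show ?thesis by (simp only: sum_index_lists_Cons)
qed

end

end

section \<open>Words arising from products of traces of powers\<close>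

definition (in power_word) word :: "(bool \<Rightarrow> 'a mat_fun) \<Rightarrow> nat \<Rightarrow> nat list \<Rightarrow> 'a list" where
  "word E s xs = map (\<lambda>v. E (eps v) (xs ! v) (xs ! rot v)) [0..<offset s]"

lemma (in power_word) rot_less: "v < offset s \<Longrightarrow> rot v < offset s"
  by (simp add: slot_less_iff[symmetric])

text \<open>Earlier letters are unaffected because \<open>rot\<close> stays inside a factor; the
  closing index \<open>hd ys\<close> is the wrap-around of \<open>rot\<close> at the last new
  letter.\<close>

lemma (in power_word) word_Suc:
  assumes "length xs = offset s" "length ys = p s"
  shows "word E (Suc s) (xs @ ys) = word E s xs @ path (E (e s)) (ys @ [hd ys])"
proof (rule nth_equalityI)
  show "length (word E (Suc s) (xs @ ys)) = length (word E s xs @ path (E (e s)) (ys @ [hd ys]))"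
    using assms by (simp add: word_def)
next
  fix v assume "v < length (word E (Suc s) (xs @ ys))"
  hence v: "v < offset s + p s" by (simp add: word_def)
  show "word E (Suc s) (xs @ ys) ! v = (word E s xs @ path (E (e s)) (ys @ [hd ys])) ! v"
  proof (cases "v < offset s")
    case True
    thus ?thesis using v rot_less[OF True] assms by (simp add: word_def nth_append)
  next
    case False
    then obtain k where k: "v = offset s + k" "k < p s" using v by (metis add_less_cancel_left le_Suc_ex not_less)
    have "ys \<noteq> []" using k assms by auto
    hence "(ys @ [hd ys]) ! Suc k = ys ! (Suc k mod p s)"
      using k assms hd_conv_nth[of ys] by (cases "Suc k = p s") (auto simp: nth_append)
    thus ?thesis using k assms slot_add[of k s] rot_add[of k s]
      by (simp add: word_def nth_append eps_def nth_path)
  qed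
qed

text \<open>The last trace is first absorbed into \<open>b\<close>; once the induction hypothesis
  has turned the others into words, it is expanded between such a word and the remaining
  \<open>b\<close>.\<close>

lemma (in star_functional) phi_trace_powers:
  assumes M: "\<And>i j. i \<in> {1..n} \<Longrightarrow> j \<in> {1..n} \<Longrightarrow> M i j \<in> carrier A"
    and "power_word p" "b \<in> carrier A"
  shows "\<phi> (list_mult A (map (\<lambda>l. star_if A (e l) (mat_trace A n (mat_pow A n M (p l)))) [0..<s]) \<otimes> b) =
    (\<Sum>xs\<in>index_lists n (power_word.offset p s).
      \<phi> (list_mult A (power_word.word p e (\<lambda>\<epsilon>. if \<epsilon> then mat_star A M else M) s xs) \<otimes> b))"
  using assms(3)
proof (induction s arbitrary: b)
  interpret power_word p e by fact
  case 0
  show ?case by (simp add: word_def)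
next
  interpret power_word p e by fact
  case (Suc s)
  let ?E = "\<lambda>\<epsilon>. if \<epsilon> then mat_star A M else M"
  define T where "T = (\<lambda>l. star_if A (e l) (mat_trace A n (mat_pow A n M (p l))))"
  have T: "T l \<in> carrier A" for l
    unfolding T_def star_if_def mat_trace_def
    using finsum_closed[of "\<lambda>i. mat_pow A n M (p l) i i" "{1..n}"] mat_pow_closed[of n M, OF M]
    by (simp add: Pi_def del: atLeastAtMost_iff)
  have Ts: "list_mult A (map T [0..<s]) \<in> carrier A" using T by (intro list_mult_closed) auto
  have E: "?E \<epsilon> i j \<in> carrier A" if "i \<in> {1..n}" "j \<in> {1..n}" for \<epsilon> i j
    using M that by (simp add: mat_star_def del: atLeastAtMost_iff)
  have w: "set (word ?E s xs) \<subseteq> carrier A" if "xs \<in> index_lists n (offset s)" for xs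
  proof -
    have "?E (eps v) (xs ! v) (xs ! rot v) \<in> carrier A" if "v < offset s" for v
      using index_lists_nth[OF \<open>xs \<in> _\<close>] rot_less that by (intro E) blast+
    thus ?thesis unfolding word_def by auto
  qed
  have "\<phi> (list_mult A (map T [0..<Suc s]) \<otimes> b) = \<phi> (list_mult A (map T [0..<s]) \<otimes> (T s \<otimes> b))"
    using T Ts Suc.prems by (simp add: list_mult_append list_mult_single m_assoc image_subset_iff)
  also have "\<dots> = (\<Sum>xs\<in>index_lists n (offset s). \<phi> (list_mult A (word ?E s xs) \<otimes> (T s \<otimes> b)))"
    unfolding T_def by (rule Suc.IH) (use T Suc.prems in \<open>auto simp: T_def\<close>)
  also have "\<dots> = (\<Sum>xs\<in>index_lists n (offset s). \<Sum>ys\<in>index_lists n (p s).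
      \<phi> (list_mult A (word ?E (Suc s) (xs @ ys)) \<otimes> b))"
  proof (rule sum.cong)
    fix xs assume xs: "xs \<in> index_lists n (offset s)"
    have wc: "list_mult A (word ?E s xs) \<in> carrier A" by (rule list_mult_closed[OF w[OF xs]])
    obtain q where q: "p s = Suc q" using p_pos[of s] by (cases "p s") auto
    have "\<phi> (list_mult A (word ?E s xs) \<otimes> (T s \<otimes> b)) = \<phi> (list_mult A (word ?E s xs) \<otimes> T s \<otimes> b)"
      using wc T Suc.prems by (simp add: m_assoc)
    also have "\<dots> = (\<Sum>ys\<in>index_lists n (p s).
        \<phi> (list_mult A (word ?E s xs) \<otimes> list_mult A (path (?E (e s)) (ys @ [hd ys])) \<otimes> b))"
      unfolding T_def q using wc Suc.prems by (intro phi_trace_power M) auto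
    also have "\<dots> = (\<Sum>ys\<in>index_lists n (p s). \<phi> (list_mult A (word ?E (Suc s) (xs @ ys)) \<otimes> b))"
    proof (rule sum.cong)
      fix ys assume ys: "ys \<in> index_lists n (p s)"
      hence "ys \<noteq> []" using q by (auto simp: index_lists_def)
      hence "set (ys @ [hd ys]) \<subseteq> {1..n}" using ys hd_in_set by (fastforce simp: index_lists_def)
      hence "set (path (?E (e s)) (ys @ [hd ys])) \<subseteq> carrier A" by (rule set_path[rotated]) (rule E)
      moreover have "word ?E (Suc s) (xs @ ys) = word ?E s xs @ path (?E (e s)) (ys @ [hd ys])"
        using xs ys by (intro word_Suc) (auto simp: index_lists_def)
      ultimately show "\<phi> (list_mult A (word ?E s xs) \<otimes> list_mult A (path (?E (e s)) (ys @ [hd ys])) \<otimes> b) =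
          \<phi> (list_mult A (word ?E (Suc s) (xs @ ys)) \<otimes> b)"
        using list_mult_append[OF w[OF xs]] by (simp only:)
    qed simp
    finally show "\<phi> (list_mult A (word ?E s xs) \<otimes> (T s \<otimes> b)) =
      (\<Sum>ys\<in>index_lists n (p s). \<phi> (list_mult A (word ?E (Suc s) (xs @ ys)) \<otimes> b))" .
  qed simp
  also have "\<dots> = (\<Sum>xs\<in>index_lists n (offset (Suc s)). \<phi> (list_mult A (word ?E (Suc s) xs) \<otimes> b))"
    by (simp only: sum_index_lists_append offset_Suc)
  finally show ?case unfolding T_def .
qed

section \<open>Contribution of a partition\<close>

text \<open>The signed Catalan number in the Haar cumulant, split off from the power of
  \<open>n\<close>.\<close>

definition haar_coeff :: "nat \<Rightarrow> complex" where
  "haar_coeff r = (-1) ^ (r div 2 - 1) *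
     (let m = r div 2 - 1 in fact (2 * m) / (fact (m + 1) * fact m))"

lemma haar_coeff_2 [simp]: "haar_coeff 2 = 1"
  by (simp add: haar_coeff_def)

text \<open>Joins the chain of equations and the closing one into a single cyclic condition. The
  unevaluated differences match the shift from the one-based indices of
  \<open>free_haar_trace\<close> to positions in a sorted list.\<close>

lemma cyclic_condition:
  assumes "r \<ge> 1"
  shows "(\<forall>l\<in>{2..r}. f (l - 1 - 1) = g (l - 1)) \<and> f (r - 1) = g (1 - 1) \<longleftrightarrow>
    (\<forall>l<r. g (Suc l mod r) = f l)" (is "?L \<longleftrightarrow> ?R")
proof
  assume L: ?L
  show ?R
  proof (intro allI impI)
    fix l assume l: "l < r"
    show "g (Suc l mod r) = f l"
    proof (cases "Suc l = r")
      case True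
      thus ?thesis using L by auto
    next
      case False
      thus ?thesis using conjunct1[OF L, rule_format, of "l + 2"] l by auto
    qed
  qed
next
  assume R: ?R
  have "f (l - 1 - 1) = g (l - 1)" if "l \<in> {2..r}" for l
  proof -
    have "Suc (l - 2) = l - 1" "l - 1 < r" "l - 2 < r" using that by auto
    thus ?thesis using R[rule_format, of "l - 2"] by (simp add: numeral_2_eq_2)
  qed
  moreover have "f (r - 1) = g (1 - 1)" using R[rule_format, of "r - 1"] assms by simp
  ultimately show ?L by blast
qed

lemma partition_on_sum_card:
  assumes "partition_on I P" "finite I"
  shows "(\<Sum>V\<in>P. card V) = card I"
proof -
  have "card (\<Union>P) = (\<Sum>V\<in>P. card V)"
    using assms partition_on_finite[OF assms]
    by (intro card_Union_disjoint) (auto simp: partition_on_def disjoint_def pairwise_def disjnt_def)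
  thus ?thesis using assms by (simp add: partition_on_def)
qed

lemma prod_power_int:
  assumes "finite P" "x \<noteq> (0 :: complex)"
  shows "(\<Prod>V\<in>P. x powi f V) = x powi (\<Sum>V\<in>P. f V)"
  using assms by (induction P) (simp_all add: power_int_add)

lemma prod_if_zero:
  assumes "finite P"
  shows "(\<Prod>V\<in>P. if Q V then f V else (0 :: complex)) = (if \<forall>V\<in>P. Q V then \<Prod>V\<in>P. f V else 0)"
  using assms by (induction P) auto

context power_word
begin

definition "alt V \<longleftrightarrow> even (card V) \<and>
  (\<forall>l. Suc l < card V \<longrightarrow> eps (sorted_list_of_set V ! l) \<noteq> eps (sorted_list_of_set V ! Suc l))"

text \<open>Consecutive letters differ by definition; the wrap-around from last to first changes the
  colour too because the number of letters is even.\<close>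

lemma alt_cyc_next:
  assumes "finite V" "alt V" "v \<in> V"
  shows "eps (cyc_next V v) \<noteq> eps v"
proof -
  let ?xs = "sorted_list_of_set V"
  obtain l where l: "l < card V" "v = ?xs ! l"
    using assms by (metis in_set_conv_nth length_sorted_list_of_set set_sorted_list_of_set)
  have parity: "eps (?xs ! k) = (eps (?xs ! 0) = even k)" if "k < card V" for k
    using that
  proof (induction k)
    case (Suc k)
    thus ?case using assms(2) by (auto simp: alt_def)
  qed simp
  show ?thesis
  proof (cases "Suc l = card V")
    case True
    hence "odd l" using assms(2) by (metis alt_def even_Suc)
    thus ?thesis using parity[of l] l cyc_next_nth[OF assms(1) l(1)] True by simp
  next
    case False
    thus ?thesis using assms(2) l cyc_next_nth[OF assms(1) l(1)] by (simp add: alt_def)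
  qed
qed

lemma alt_pair:
  assumes "card V = 2" "\<And>v. v \<in> V \<Longrightarrow> eps (cyc_next V v) \<noteq> eps v"
  shows "alt V"
proof -
  have fin: "finite V" using assms(1) card.infinite by fastforce
  have "sorted_list_of_set V ! 0 \<in> V"
    using fin assms(1) by (metis length_sorted_list_of_set nth_mem pos2 set_sorted_list_of_set)
  thus ?thesis
    using assms cyc_next_nth[OF fin, of 0] by (force simp: alt_def less_Suc_eq)
qed

text \<open>The second index at \<open>v\<close> is \<open>xs ! rot v\<close>, so the index
  condition of the cumulant equates it with the first index at the next position of the
  block.\<close>

lemma haar_cumulant:
  assumes h: "free_haar_trace n h" and V: "V \<subseteq> {..< offset s}" "V \<noteq> {}"
    and xs: "xs \<in> index_lists n (offset s)"
  shows "free_cumulant (brown n) h (nths (word (brown_entry n) s xs) V) =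
    (if alt V \<and> (\<forall>v\<in>V. xs ! cyc_next V v = xs ! rot v)
     then of_nat n powi (1 - int (card V)) * haar_coeff (card V) else 0)"
proof -
  define ys where "ys = sorted_list_of_set V"
  define r where "r = card V"
  have fin: "finite V" using V(1) finite_subset by blast
  have r: "r \<ge> 1" "length ys = r" using fin V(2) by (auto simp: r_def ys_def Suc_le_eq card_gt_0_iff)
  have ys_less: "ys ! l < offset s" if "l < r" for l
    using that r V fin by (metis (no_types, lifting) lessThan_iff nth_mem set_sorted_list_of_set subsetD ys_def)
  define \<epsilon> i j where "\<epsilon> l = eps (ys ! (l - 1))" and "i l = xs ! (ys ! (l - 1))"
    and "j l = xs ! rot (ys ! (l - 1))" for l
  have ij: "\<forall>l\<in>{1..r}. i l \<in> {1..n} \<and> j l \<in> {1..n}"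
  proof
    fix l assume "l \<in> {1..r}"
    hence "ys ! (l - 1) < offset s" by (intro ys_less) auto
    thus "i l \<in> {1..n} \<and> j l \<in> {1..n}"
      unfolding i_def j_def using index_lists_nth[OF xs] rot_less by blast
  qed
  have "nths (word (brown_entry n) s xs) V =
      map (\<lambda>v. brown_entry n (eps v) (xs ! v) (xs ! rot v)) ys"
    unfolding word_def ys_def by (rule nths_map_upt[OF V(1)])
  also have "\<dots> = map (\<lambda>l. brown_entry n (\<epsilon> l) (i l) (j l)) [1..<Suc r]"
    by (rule nth_equalityI) (use r in \<open>auto simp: \<epsilon>_def i_def j_def simp del: upt_Suc\<close>)
  finally have "free_cumulant (brown n) h (nths (word (brown_entry n) s xs) V) =
      (if (\<forall>l\<in>{2..r}. j (l - 1) = i l) \<and> j r = i 1 \<and> even r \<and> (\<forall>l\<in>{1..<r}. \<epsilon> l \<noteq> \<epsilon> (l + 1))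
       then of_nat n powi (1 - int r) * haar_coeff r else 0)"
    using h ij r(1) unfolding free_haar_trace_def haar_coeff_def by (simp only: mult.assoc)
  moreover have "(\<forall>l\<in>{2..r}. j (l - 1) = i l) \<and> j r = i 1 \<longleftrightarrow>
      (\<forall>v\<in>V. xs ! cyc_next V v = xs ! rot v)"
  proof -
    have "(\<forall>l\<in>{2..r}. j (l - 1) = i l) \<and> j r = i 1 \<longleftrightarrow>
        (\<forall>l<r. xs ! (ys ! (Suc l mod r)) = xs ! rot (ys ! l))"
      using cyclic_condition[OF r(1), of "\<lambda>l. xs ! rot (ys ! l)" "\<lambda>l. xs ! (ys ! l)"]
      by (simp only: i_def j_def)
    also have "\<dots> \<longleftrightarrow> (\<forall>l<r. xs ! cyc_next V (ys ! l) = xs ! rot (ys ! l))"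
      using cyc_next_nth[OF fin] by (simp add: ys_def r_def)
    finally show ?thesis using ball_sorted_list_of_set[OF fin] by (simp add: ys_def r_def)
  qed
  moreover have "even r \<and> (\<forall>l\<in>{1..<r}. \<epsilon> l \<noteq> \<epsilon> (l + 1)) \<longleftrightarrow> alt V"
  proof -
    have "(\<forall>l\<in>{1..<r}. \<epsilon> l \<noteq> \<epsilon> (l + 1)) \<longleftrightarrow> (\<forall>l. Suc l < r \<longrightarrow> \<epsilon> (Suc l) \<noteq> \<epsilon> (Suc l + 1))"
      by (metis One_nat_def Suc_le_D atLeastLessThan_iff le_add1 plus_1_eq_Suc)
    thus ?thesis by (simp add: alt_def \<epsilon>_def ys_def r_def)
  qed
  ultimately show ?thesis unfolding r_def[symmetric] by (metis (no_types, lifting))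
qed

definition "invariant_lists n s P =
  {xs \<in> index_lists n (offset s). \<forall>v< offset s. xs ! part_next P v = xs ! rot v}"

definition "contribution n s P =
  (if \<forall>V\<in>P. alt V then of_nat (card (invariant_lists n s P)) *
     (of_nat n powi (int (card P) - int (offset s)) * (\<Prod>V\<in>P. haar_coeff (card V))) else (0 :: complex))"

lemma NC_partition: "P \<in> NC s \<Longrightarrow> partition_on {..<s} P"
  by (simp add: NC_def)

text \<open>The product depends on the index list only through the block conditions, which combine
  into membership in \<open>invariant_lists\<close>; hence the sum counts lists. The exponent of
  \<open>n\<close> is the total of \<open>1 - card V\<close> over the blocks.\<close>

lemma sum_prod_cumulants:
  assumes h: "free_haar_trace n h" and n: "n \<ge> 1" and P: "P \<in> NC (offset s)"
  shows "(\<Sum>xs\<in>index_lists n (offset s).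
      \<Prod>V\<in>P. free_cumulant (brown n) h (nths (word (brown_entry n) s xs) V)) = contribution n s P"
proof -
  note part = NC_partition[OF P]
  have fin: "finite P" using partition_on_finite(1)[OF part] by simp
  let ?c = "of_nat n powi (int (card P) - int (offset s)) * (\<Prod>V\<in>P. haar_coeff (card V)) :: complex"
  have V: "V \<subseteq> {..< offset s}" "V \<noteq> {}" if "V \<in> P" for V
    using part that by (auto simp: partition_on_def)
  have "(\<Prod>V\<in>P. free_cumulant (brown n) h (nths (word (brown_entry n) s xs) V)) =
      (if (\<forall>V\<in>P. alt V) \<and> xs \<in> invariant_lists n s P then ?c else 0)"
    if xs: "xs \<in> index_lists n (offset s)" for xs
  proof -
    have "(\<Prod>V\<in>P. free_cumulant (brown n) h (nths (word (brown_entry n) s xs) V)) =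
        (\<Prod>V\<in>P. if alt V \<and> (\<forall>v\<in>V. xs ! cyc_next V v = xs ! rot v)
          then of_nat n powi (1 - int (card V)) * haar_coeff (card V) else 0)"
      using haar_cumulant[OF h V xs] by (intro prod.cong) auto
    also have "\<dots> = (if \<forall>V\<in>P. alt V \<and> (\<forall>v\<in>V. xs ! cyc_next V v = xs ! rot v)
        then \<Prod>V\<in>P. of_nat n powi (1 - int (card V)) * haar_coeff (card V) else 0)"
      by (rule prod_if_zero[OF fin])
    also have "(\<Prod>V\<in>P. of_nat n powi (1 - int (card V)) * haar_coeff (card V)) = ?c"
    proof -
      have "(\<Sum>V\<in>P. 1 - int (card V)) = int (card P) - int (\<Sum>V\<in>P. card V)"
        by (simp add: sum_subtractf)
      also have "(\<Sum>V\<in>P. card V) = offset s" using partition_on_sum_card[OF part] by simp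
      finally show ?thesis using n fin by (simp add: prod.distrib prod_power_int)
    qed
    also have "(\<forall>V\<in>P. alt V \<and> (\<forall>v\<in>V. xs ! cyc_next V v = xs ! rot v)) \<longleftrightarrow>
        (\<forall>V\<in>P. alt V) \<and> xs \<in> invariant_lists n s P"
    proof -
      have "(\<forall>v< offset s. xs ! part_next P v = xs ! rot v) \<longleftrightarrow>
          (\<forall>v\<in>\<Union>P. xs ! part_next P v = xs ! rot v)"
        unfolding partition_onD1[OF part, symmetric] by auto
      also have "\<dots> \<longleftrightarrow> (\<forall>V\<in>P. \<forall>v\<in>V. xs ! cyc_next V v = xs ! rot v)"
        using part_next_eq[OF part] by auto
      finally show ?thesis using xs by (auto simp: invariant_lists_def)
    qed
    finally show ?thesis .
  qed
  hence "(\<Sum>xs\<in>index_lists n (offset s).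
      \<Prod>V\<in>P. free_cumulant (brown n) h (nths (word (brown_entry n) s xs) V)) =
      (\<Sum>xs\<in>index_lists n (offset s). if (\<forall>V\<in>P. alt V) \<and> xs \<in> invariant_lists n s P then ?c else 0)"
    by (intro sum.cong) auto
  also have "\<dots> = contribution n s P"
  proof (cases "\<forall>V\<in>P. alt V")
    case True
    have "(\<Sum>xs\<in>index_lists n (offset s). if xs \<in> invariant_lists n s P then ?c else 0) =
        (\<Sum>xs\<in>index_lists n (offset s) \<inter> invariant_lists n s P. ?c)"
      by (rule sum.inter_restrict[OF finite_index_lists, symmetric])
    also have "index_lists n (offset s) \<inter> invariant_lists n s P = invariant_lists n s P"
      by (auto simp: invariant_lists_def)
    finally show ?thesis using True by (simp add: contribution_def)
  next
    case False
    hence no: "(\<forall>V\<in>P. alt V) = False" by blast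
    show ?thesis unfolding contribution_def no by simp
  qed
  finally show ?thesis .
qed

section \<open>The limit of a single contribution\<close>

lemma power_int_bound:
  assumes "c \<le> n ^ k" "k + q < N" "n \<ge> 1"
  shows "real c * real n powi (int q - int N) \<le> 1 / real n"
proof -
  have "real c * real n powi (int q - int N) \<le> real n ^ k * real n powi (int q - int N)"
    using assms(1) by (intro mult_right_mono) (simp_all flip: of_nat_power)
  also have "\<dots> = real n powi (int k + int q - int N)"
    using assms(3) by (simp add: power_int_add power_int_diff)
  also have "\<dots> \<le> real n powi (-1)"
    using assms by (intro power_int_increasing) auto
  finally show ?thesis by (simp add: power_int_minus divide_inverse)
qed

text \<open>With \<open>\<tau> = part_next P \<circ> rot\<^sup>-\<^sup>1\<close>, which changes the colour \<open>eps\<close> at each position,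
  invariant lists are those constant on the cycles of \<open>\<tau>\<close>.\<close>

lemma contribution_limit:
  assumes P: "P \<in> NC (offset s)"
  shows "(\<lambda>n. contribution n s P) \<longlonglongrightarrow>
    (if P \<in> NC2 (offset s) \<and> word_match s (part_next P) then 1 else 0)"
proof (cases "\<forall>V\<in>P. alt V")
  case False
  \<comment> \<open>The contribution vanishes here; the claimed limit vanishes too, since a
    compatible pairing has alternating blocks.\<close>
  have "\<forall>V\<in>P. alt V" if "P \<in> NC2 (offset s)" "word_match s (part_next P)"
  proof
    fix V assume V: "V \<in> P"
    have "v < offset s" if "v \<in> V" for v
      using partition_onD1[OF NC_partition[OF P]] V that by blast
    hence "eps (cyc_next V v) \<noteq> eps v" if "v \<in> V" for v
      using \<open>word_match s (part_next P)\<close> part_next_eq[OF NC_partition[OF P] V that] that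
      unfolding word_match_def by metis
    thus "alt V"
      using \<open>P \<in> NC2 (offset s)\<close> V by (intro alt_pair) (simp_all add: NC2_def)
  qed
  hence good: "\<not> (P \<in> NC2 (offset s) \<and> word_match s (part_next P))" using False by blast
  have no: "(\<forall>V\<in>P. alt V) = False" using False by blast
  show ?thesis unfolding contribution_def no if_not_P[OF good] by simp
next
  case alt: True
  let ?N = "offset s"
  define q where "q = part_next P"
  define g where "g = inv_into {..< ?N} rot"
  define \<tau> where "\<tau> = q \<circ> g"
  note part = NC_partition[OF P]
  have fin: "finite P" "\<And>V. V \<in> P \<Longrightarrow> finite V" using partition_on_finite[OF part] by auto
  have bq: "bij_betw q {..< ?N} {..< ?N}" unfolding q_def by (rule bij_part_next[OF part]) simp
  have bg: "bij_betw g {..< ?N} {..< ?N}" unfolding g_def by (rule bij_betw_inv_into[OF bij_rot])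
  have b\<tau>: "bij_betw \<tau> {..< ?N} {..< ?N}" unfolding \<tau>_def by (rule bij_betw_trans[OF bg bq])
  have q_less: "q v < ?N" and g_less: "g v < ?N" if "v < ?N" for v
    using bq bg that by (auto simp: bij_betw_def)
  have rot_g: "rot (g v) = v" if "v < ?N" for v
    using bij_rot[of s] that by (simp add: g_def bij_betw_inv_into_right)
  have g_rot: "g (rot v) = v" if "v < ?N" for v
    using bij_rot[of s] that by (simp add: g_def bij_betw_inv_into_left)
  have \<tau>_rot: "\<tau> (rot v) = q v" if "v < ?N" for v using g_rot[OF that] by (simp add: \<tau>_def)
  have eps_q: "eps (q v) = (\<not> eps v)" if "v < ?N" for v
  proof -
    have "v \<in> \<Union>P" using that unfolding partition_onD1[OF part, symmetric] by simp
    then obtain V where V: "V \<in> P" "v \<in> V" by blast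
    have "eps (cyc_next V v) \<noteq> eps v" using alt V by (intro alt_cyc_next fin(2)) auto
    thus ?thesis using part_next_eq[OF part V] by (simp add: q_def)
  qed
  \<comment> \<open>\<open>rot\<close> keeps the colour of its factor, while \<open>q\<close> moves
    along alternating blocks.\<close>
  have swap: "eps (\<tau> v) = (\<not> eps v)" if "v < ?N" for v
    using eps_q[OF g_less[OF that]] rot_g[OF that] eps_rot[of "g v"] by (simp add: \<tau>_def)
  have inv: "invariant_lists n s P = inv_lists ?N \<tau> n" for n
  proof -
    have "(\<forall>v< ?N. xs ! q v = xs ! rot v) \<longleftrightarrow> (\<forall>v< ?N. xs ! \<tau> v = xs ! v)" for xs :: "nat list"
    proof
      assume *: "\<forall>v< ?N. xs ! q v = xs ! rot v"
      show "\<forall>v< ?N. xs ! \<tau> v = xs ! v" using * g_less rot_g by (simp add: \<tau>_def)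
    next
      assume *: "\<forall>v< ?N. xs ! \<tau> v = xs ! v"
      show "\<forall>v< ?N. xs ! q v = xs ! rot v" using * rot_less \<tau>_rot by metis
    qed
    thus ?thesis by (simp add: invariant_lists_def inv_lists_def q_def)
  qed
  have evenN: "even ?N"
    using card_swap_half[OF _ b\<tau>, of eps] swap by (metis card_lessThan dvd_triv_left finite_lessThan lessThan_iff)
  have two: "card V \<ge> 2" if "V \<in> P" for V
  proof -
    have "V \<noteq> {}" using part that by (auto simp: partition_on_def)
    hence "card V > 0" using fin(2)[OF that] by (simp add: card_gt_0_iff)
    moreover have "even (card V)" using alt that by (simp add: alt_def)
    ultimately show ?thesis by presburger
  qed
  have sumP: "(\<Sum>V\<in>P. card V) = ?N" using partition_on_sum_card[OF part] by simp
  define C where "C = (\<Prod>V\<in>P. haar_coeff (card V))"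
  have contr: "contribution n s P = of_nat (card (inv_lists ?N \<tau> n)) *
      (of_nat n powi (int (card P) - int ?N) * C)" for n
    using alt by (simp add: contribution_def inv C_def)
  \<comment> \<open>Both ways of missing the maximum, a block larger than a pair and a cycle of
    \<tau> longer than 2, end here with a power of \<open>n\<close> lost.\<close>
  have null: "(\<lambda>n. contribution n s P) \<longlonglongrightarrow> 0"
    if k: "\<And>n. card (inv_lists ?N \<tau> n) \<le> n ^ k" "k + card P < ?N" for k
  proof (rule tendsto_0_le)
    show "(\<lambda>n. 1 / real n) \<longlonglongrightarrow> 0" by (rule lim_1_over_n)
    show "\<forall>\<^sub>F n in sequentially. norm (contribution n s P) \<le> norm (1 / real n) * norm C"
    proof (rule eventually_sequentiallyI[of 1])
      fix n :: nat assume "1 \<le> n"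
      hence "real (card (inv_lists ?N \<tau> n)) * real n powi (int (card P) - int ?N) \<le> 1 / real n"
        by (rule power_int_bound[OF k])
      hence "real (card (inv_lists ?N \<tau> n)) * real n powi (int (card P) - int ?N) * norm C \<le>
          1 / real n * norm C" by (rule mult_right_mono) simp
      thus "norm (contribution n s P) \<le> norm (1 / real n) * norm C"
        by (simp add: contr norm_mult norm_power_int mult_ac)
    qed
  qed
  show ?thesis
  proof (cases "P \<in> NC2 ?N")
    case False
    then obtain V where "V \<in> P" "card V \<noteq> 2" using P by (auto simp: NC2_def)
    hence "2 < card V" using two[of V] by simp
    hence "(\<Sum>V\<in>P. 2) < (\<Sum>V\<in>P. card V)"
      using two \<open>V \<in> P\<close> fin(1) by (intro sum_strict_mono_ex1) auto
    hence "?N div 2 + card P < ?N" using sumP evenN by auto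
    thus ?thesis using null[OF card_inv_lists_le[where \<epsilon> = eps, OF b\<tau> swap]] False by simp
  next
    case NC2: True
    hence c2: "card V = 2" if "V \<in> P" for V using that by (simp add: NC2_def)
    have cardP: "?N = 2 * card P" using sumP c2 by simp
    have qq: "q (q v) = v" if "v < ?N" for v
      using NC2_invol(1)[OF NC2] that by (simp add: nc_invol_def q_def)
    show ?thesis
    proof (cases "\<exists>v< ?N. \<tau> (\<tau> v) \<noteq> v")
      case True
      then obtain v where v: "v < ?N" "\<tau> (\<tau> v) \<noteq> v" by blast
      have "\<not> word_match s q"
      proof
        assume "word_match s q"
        \<comment> \<open>This is \<open>word_match\<close> at \<open>g v\<close>, where
          \<open>rot (g v) = v\<close>.\<close>
        hence "rot (q v) = q (g v)" using rot_g[OF v(1)] g_less[OF v(1)] unfolding word_match_def by metis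
        hence "\<tau> (\<tau> v) = q (q v)"
          using g_rot[OF q_less[OF v(1)]] by (simp add: \<tau>_def flip: \<open>rot (q v) = q (g v)\<close>)
        thus False using qq v by simp
      qed
      moreover have "?N div 2 - 1 + card P < ?N" using cardP v(1) by simp
      ultimately show ?thesis
        using null[OF card_inv_lists_less[where \<epsilon> = eps, OF b\<tau> swap v]] by (simp add: q_def)
    next
      case False
      have "word_match s q"
        unfolding word_match_def
      proof (intro allI impI conjI)
        fix v assume v: "v < ?N"
        show "eps (q v) \<noteq> eps v" using eps_q[OF v] by simp
        \<comment> \<open>The involution property of \<tau> at \<open>rot v\<close>, where \<tau>
          takes the value \<open>q v\<close>.\<close>
        have "\<tau> (q v) = rot v" using False \<tau>_rot[OF v] rot_less[OF v] by metis
        hence "q (q (g (q v))) = q (rot v)" by (simp add: \<tau>_def)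
        hence "g (q v) = q (rot v)" using qq g_less q_less v by metis
        thus "rot (q (rot v)) = q v" using rot_g[OF q_less[OF v]] by simp
      qed
      moreover have "C = 1" unfolding C_def using c2 by simp
      moreover have "contribution n s P = 1" if "n \<ge> 1" for n
      proof -
        have "card (inv_lists ?N \<tau> n) = n ^ card P"
          using card_inv_lists_eq[where \<epsilon> = eps, OF b\<tau> swap] False cardP by simp
        thus ?thesis using \<open>C = 1\<close> that cardP
          by (simp add: contr power_int_minus)
      qed
      hence "(\<lambda>n. contribution n s P) \<longlonglongrightarrow> 1"
        by (intro tendsto_eventually eventually_sequentiallyI[of 1])
      ultimately show ?thesis using NC2 by (simp add: q_def)
    qed
  qed
qed

text \<open>After the two sums are exchanged, the outer one runs over a finite set independent of
  \<open>n\<close>, so limits can be taken term by term.\<close>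

lemma haar_moment_limit:
  assumes h: "\<And>n. n \<ge> 1 \<Longrightarrow> free_haar_trace n (h n)" and "s \<ge> 1"
  shows "(\<lambda>n. h n (list_mult (brown n) (map (\<lambda>l. star_if (brown n) (e l) (brown_chi n (p l))) [0..<s])))
     \<longlonglongrightarrow> of_nat (card {Q \<in> NC2 s. slot_match s (part_next Q)})"
proof -
  let ?m = "\<lambda>n. h n (list_mult (brown n) (map (\<lambda>l. star_if (brown n) (e l) (brown_chi n (p l))) [0..<s]))"
  let ?N = "offset s"
  have N: "?N \<ge> 1" using le_offset[of s] assms(2) by linarith
  have eq: "?m n = (\<Sum>P\<in>NC ?N. contribution n s P)" if n: "n \<ge> 1" for n
  proof -
    interpret complex_star_algebra "brown n" by (rule brown)
    have lin: "unital_linear_functional (brown n) (h n)"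
      using h[OF n] by (simp add: free_haar_trace_def)
    interpret star_functional "brown n" "h n" by unfold_locales (rule lin)
    let ?T = "\<lambda>l. star_if (brown n) (e l) (brown_chi n (p l))"
    have entry: "brown_entry n = (\<lambda>\<epsilon>. if \<epsilon> then mat_star (brown n) (brown_u n) else brown_u n)"
      by (simp add: brown_entry_def fun_eq_iff)
    have u: "brown_entry n \<epsilon> i j \<in> carrier (brown n)" if "i \<in> {1..n}" "j \<in> {1..n}" for \<epsilon> i j
      using that brown_u_closed[of _ n] by (simp add: entry mat_star_def)
    have chi: "brown_chi n q \<in> carrier (brown n)" for q
      unfolding brown_chi_def mat_trace_def using mat_pow_closed[of n "brown_u n", OF brown_u_closed]
      by (intro finsum_closed) blast
    have T: "list_mult (brown n) (map ?T [0..<s]) \<in> carrier (brown n)"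
      using chi by (intro list_mult_closed) (auto simp: star_if_def)
    have w: "list_mult (brown n) (word (brown_entry n) s xs) \<in> carrier (brown n)"
      if "xs \<in> index_lists n ?N" for xs
    proof (rule list_mult_closed)
      have "brown_entry n (eps v) (xs ! v) (xs ! rot v) \<in> carrier (brown n)" if "v < ?N" for v
        using index_lists_nth[OF \<open>xs \<in> _\<close>] rot_less that by (intro u) blast+
      thus "set (word (brown_entry n) s xs) \<subseteq> carrier (brown n)" by (auto simp: word_def)
    qed
    have "?m n = h n (list_mult (brown n) (map ?T [0..<s]) \<otimes>\<^bsub>brown n\<^esub> \<one>\<^bsub>brown n\<^esub>)"
      using T by simp
    also have "\<dots> = (\<Sum>xs\<in>index_lists n ?N.
        h n (list_mult (brown n) (word (brown_entry n) s xs) \<otimes>\<^bsub>brown n\<^esub> \<one>\<^bsub>brown n\<^esub>))"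
      unfolding brown_chi_def entry
      by (rule phi_trace_powers[OF brown_u_closed power_word_axioms one_closed])
    also have "\<dots> = (\<Sum>xs\<in>index_lists n ?N. h n (list_mult (brown n) (word (brown_entry n) s xs)))"
      using w by (intro sum.cong) auto
    also have "\<dots> = (\<Sum>xs\<in>index_lists n ?N. \<Sum>P\<in>NC ?N.
        \<Prod>V\<in>P. free_cumulant (brown n) (h n) (nths (word (brown_entry n) s xs) V))"
    proof (rule sum.cong)
      fix xs
      have len: "length (word (brown_entry n) s xs) = ?N" by (simp add: word_def)
      hence "word (brown_entry n) s xs \<noteq> []" using N by (metis list.size(3) not_one_le_zero)
      from moment_cumulant[OF this, of "h n" "brown n"]
      show "h n (list_mult (brown n) (word (brown_entry n) s xs)) = (\<Sum>P\<in>NC ?N.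
          \<Prod>V\<in>P. free_cumulant (brown n) (h n) (nths (word (brown_entry n) s xs) V))"
        by (simp only: len)
    qed simp
    also have "\<dots> = (\<Sum>P\<in>NC ?N. \<Sum>xs\<in>index_lists n ?N.
        \<Prod>V\<in>P. free_cumulant (brown n) (h n) (nths (word (brown_entry n) s xs) V))"
      by (rule sum.swap)
    also have "\<dots> = (\<Sum>P\<in>NC ?N. contribution n s P)"
      by (intro sum.cong refl sum_prod_cumulants[OF h[OF n] n])
    finally show ?thesis .
  qed
  have "(\<lambda>n. \<Sum>P\<in>NC ?N. contribution n s P) \<longlonglongrightarrow>
      (\<Sum>P\<in>NC ?N. if P \<in> NC2 ?N \<and> word_match s (part_next P) then 1 else 0)"
    by (intro tendsto_sum contribution_limit)
  also have "(\<Sum>P\<in>NC ?N. if P \<in> NC2 ?N \<and> word_match s (part_next P) then 1 else 0 :: complex) =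
      of_nat (card {P \<in> NC ?N. P \<in> NC2 ?N \<and> word_match s (part_next P)})"
    using finite_NC by (simp add: sum.If_cases Int_def)
  also have "{P \<in> NC ?N. P \<in> NC2 ?N \<and> word_match s (part_next P)} =
      {P \<in> NC2 ?N. word_match s (part_next P)}" by (auto simp: NC2_def)
  finally have "(\<lambda>n. \<Sum>P\<in>NC ?N. contribution n s P) \<longlonglongrightarrow>
      of_nat (card {Q \<in> NC2 s. slot_match s (part_next Q)})"
    by (simp only: card_compat_pairings)
  moreover have "\<forall>\<^sub>F n in sequentially. (\<Sum>P\<in>NC ?N. contribution n s P) = ?m n"
    using eq by (intro eventually_sequentiallyI[of 1]) simp
  ultimately show ?thesis by (rule Lim_transform_eventually)
qed

section \<open>Moments of a circular family\<close>

lemma circular_moment: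
  assumes c: "free_circular_family B \<psi> c" and "s \<ge> 1"
  shows "\<psi> (list_mult B (map (\<lambda>l. star_if B (e l) (c (p l))) [0..<s])) =
    of_nat (card {Q \<in> NC2 s. slot_match s (part_next Q)})"
proof -
  let ?w = "map (\<lambda>l. star_if B (e l) (c (p l))) [0..<s]"
  \<comment> \<open>The condition is put symmetrically on both members and through
    \<open>cyc_next\<close>, so that over all blocks together it becomes \<open>slot_match\<close>
    of \<open>part_next\<close>.\<close>
  define ok where "ok V \<longleftrightarrow> card V = 2 \<and> (\<forall>a\<in>V. p (cyc_next V a) = p a \<and> e (cyc_next V a) \<noteq> e a)" for V
  have \<kappa>: "free_cumulant B \<psi> (nths ?w V) = (if ok V then 1 else 0)"
    if V: "V \<subseteq> {..<s}" "V \<noteq> {}" for V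
  proof -
    define ys where "ys = sorted_list_of_set V"
    define r where "r = card V"
    have fin: "finite V" using V(1) finite_subset by blast
    have r: "r \<ge> 1" "length ys = r" using fin V(2) by (auto simp: r_def ys_def Suc_le_eq card_gt_0_iff)
    define p' e' where "p' l = p (ys ! (l - 1))" and "e' l = e (ys ! (l - 1))" for l
    have "nths ?w V = map (\<lambda>l. star_if B (e l) (c (p l))) ys"
      unfolding ys_def by (rule nths_map_upt[OF V(1)])
    also have "\<dots> = map (\<lambda>l. star_if B (e' l) (c (p' l))) [1..<Suc r]"
      by (rule nth_equalityI) (use r in \<open>auto simp: p'_def e'_def simp del: upt_Suc\<close>)
    finally have nths: "nths ?w V = map (\<lambda>l. star_if B (e' l) (c (p' l))) [1..<Suc r]" .
    have "\<forall>l\<in>{1..r}. p' l \<ge> 1" using p_pos by (simp add: p'_def)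
    hence "free_cumulant B \<psi> (nths ?w V) =
        (if r = 2 \<and> p' 1 = p' 2 \<and> e' 1 \<noteq> e' 2 then 1 else 0)"
      using c r(1) unfolding free_circular_family_def nths by blast
    moreover have "r = 2 \<and> p' 1 = p' 2 \<and> e' 1 \<noteq> e' 2 \<longleftrightarrow> ok V"
    proof (cases "r = 2")
      case True
      hence cyc: "cyc_next V (ys ! 0) = ys ! 1" "cyc_next V (ys ! 1) = ys ! 0"
        using cyc_next_nth[OF fin, of 0] cyc_next_nth[OF fin, of 1] by (simp_all add: ys_def r_def)
      have "V = {ys ! 0, ys ! 1}"
      proof -
        obtain a b where "ys = [a, b]"
          using r True by (metis length_0_conv length_Suc_conv numeral_2_eq_2)
        thus ?thesis using fin set_sorted_list_of_set[of V] by (simp add: ys_def)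
      qed
      hence "(\<forall>a\<in>V. p (cyc_next V a) = p a \<and> e (cyc_next V a) \<noteq> e a) \<longleftrightarrow>
          (\<forall>a\<in>{ys ! 0, ys ! 1}. p (cyc_next V a) = p a \<and> e (cyc_next V a) \<noteq> e a)"
        by (rule ball_cong) (rule refl)
      also have "\<dots> \<longleftrightarrow> p (ys ! 1) = p (ys ! 0) \<and> e (ys ! 1) \<noteq> e (ys ! 0)"
        unfolding ball_simps cyc by metis
      finally have "ok V \<longleftrightarrow> p (ys ! 1) = p (ys ! 0) \<and> e (ys ! 1) \<noteq> e (ys ! 0)"
        using True unfolding ok_def r_def by blast
      moreover have "p' 1 = p (ys ! 0)" "p' 2 = p (ys ! 1)" "e' 1 = e (ys ! 0)" "e' 2 = e (ys ! 1)"
        by (simp_all add: p'_def e'_def)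
      ultimately show ?thesis using True by metis
    qed (simp add: ok_def r_def)
    ultimately show ?thesis by simp
  qed
  have "?w \<noteq> []" "length ?w = s" using assms(2) by auto
  hence "\<psi> (list_mult B ?w) = (\<Sum>Q\<in>NC s. \<Prod>V\<in>Q. free_cumulant B \<psi> (nths ?w V))"
    using moment_cumulant[of ?w \<psi> B] by simp
  also have "\<dots> = (\<Sum>Q\<in>NC s. if \<forall>V\<in>Q. ok V then 1 else 0)"
  proof (rule sum.cong)
    fix Q assume "Q \<in> NC s"
    hence part: "partition_on {..<s} Q" by (rule NC_partition)
    have "(\<Prod>V\<in>Q. free_cumulant B \<psi> (nths ?w V)) = (\<Prod>V\<in>Q. if ok V then 1 else 0)"
      using part by (intro prod.cong \<kappa>) (auto simp: partition_on_def)
    thus "(\<Prod>V\<in>Q. free_cumulant B \<psi> (nths ?w V)) = (if \<forall>V\<in>Q. ok V then 1 else 0)"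
      using partition_on_finite(1)[OF part] by (simp add: prod_if_zero)
  qed simp
  also have "\<dots> = of_nat (card {Q \<in> NC s. \<forall>V\<in>Q. ok V})"
    using finite_NC by (simp add: sum.If_cases Int_def)
  also have "{Q \<in> NC s. \<forall>V\<in>Q. ok V} = {Q \<in> NC2 s. slot_match s (part_next Q)}"
  proof -
    have "(\<forall>V\<in>Q. ok V) \<longleftrightarrow> (\<forall>V\<in>Q. card V = 2) \<and> slot_match s (part_next Q)" if "Q \<in> NC s" for Q
    proof -
      note part = NC_partition[OF that]
      have "slot_match s (part_next Q) \<longleftrightarrow>
          (\<forall>a\<in>\<Union>Q. p (part_next Q a) = p a \<and> e (part_next Q a) \<noteq> e a)"
        unfolding partition_onD1[OF part, symmetric] slot_match_def by auto
      also have "\<dots> \<longleftrightarrow> (\<forall>V\<in>Q. \<forall>a\<in>V. p (cyc_next V a) = p a \<and> e (cyc_next V a) \<noteq> e a)"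
        using part_next_eq[OF part] by auto
      finally show ?thesis by (auto simp: ok_def)
    qed
    thus ?thesis unfolding NC2_def by blast
  qed
  finally show ?thesis .
qed

end

theorem theorem3p1:
  fixes h :: "nat \<Rightarrow> (nat \<times> nat) star_poly set \<Rightarrow> complex"
    and B :: "('b, 'm) star_algebra_scheme"
    and \<psi> :: "'b \<Rightarrow> complex"
    and c :: "nat \<Rightarrow> 'b"
  assumes haar: "\<And>n. n \<ge> 1 \<Longrightarrow> free_haar_trace n (h n)"
    and space: "star_prob_space B \<psi>"
    and circular: "free_circular_family B \<psi> c"
  shows "converges_in_star_distribution brown h brown_chi B \<psi> c"
  unfolding converges_in_star_distribution_def
proof (intro allI impI)
  fix s p e assume s: "s \<ge> (1 :: nat)" and p: "\<forall>l\<in>{1..s}. (1 :: nat) \<le> p l"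
  \<comment> \<open>One-based data become zero-based; beyond the \<open>s\<close> factors the
    exponent is set to 1, because the locale asks for positive exponents everywhere.\<close>
  define p' where "p' l = (if l < s then p (Suc l) else 1)" for l
  interpret power_word p' "\<lambda>l. e (Suc l)" by unfold_locales (use p in \<open>auto simp: p'_def\<close>)
  have shift: "map (\<lambda>l. star_if A (e l) (a (p l))) [1..<Suc s] =
      map (\<lambda>l. star_if A (e (Suc l)) (a (p' l))) [0..<s]"
    for A :: "('x, 'y) star_algebra_scheme" and a
    by (rule nth_equalityI) (auto simp: p'_def simp del: upt_Suc)
  show "(\<lambda>n. joint_star_moment (brown n) (h n) (brown_chi n) s p e)
      \<longlonglongrightarrow> joint_star_moment B \<psi> c s p e"
    unfolding joint_star_moment_def shift circular_moment[OF circular s]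
    by (rule haar_moment_limit[OF haar s])
qed

end
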